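(* The system $$A^2u+C_uAu+k(u-v)=0,\qquad A^2v+C_vAv-k(u-v)=0,$$ with $C_u=\beta+\varrho\|u\|_1^2$, $C_v=\beta+\varrho\|v\|_1^2$, admits bimodal solutions of not equidistributed energy if and only if the set $\mathbb{B}^\star$ is nonempty. More precisely, for every couple $(n_1,n_2)\in\mathbb{N}\times\mathbb{N}$ with $n_1<n_2$, one of the following disjoint situations occurs. (1) If $(n_1,n_2)\in\mathbb{B}^\star$, there are exactly 8 distinct bimodal solutions of not equidistributed energy involving $e_{n_1}$ and $e_{n_2}$: 4 of the form $$u=re_{n_1}+te_{n_2},\qquad v=rXe_{n_1}+tWe_{n_2},$$ where $(r,t)\in\mathbb{R}^2$ solves $$\varrho r^2\lambda_{n_1}+\varrho t^2\lambda_{n_2}+\beta=f,\qquad \varrho r^2\lambda_{n_1}X^2+\varrho t^2\lambda_{n_2}W^2+\beta=g,$$ and 4 of the form $$u=re_{n_1}+te_{n_2},\qquad v=rYe_{n_1}+tZe_{n_2},$$ where $(r,t)\in\mathbb{R}^2$ solves $$\varrho r^2\lambda_{n_1}+\varrho t^2\lambda_{n_2}+\beta=g,\qquad \varrho r^2\lambda_{n_1}Y^2+\varrho t^2\lambda_{n_2}Z^2+\beta=f.$$ (2) If $(n_1,n_2)\notin\mathbb{B}^\star$, there are no bimodal solutions of not equidistributed energy involving the eigenvectors $e_{n_1}$ and $e_{n_2}$. In summary, the system admits $8|\mathbb{B}^\star|$ bimodal solutions of not equidistributed energy.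
   Context: Let $H$ be a separable real Hilbert space with inner product $\langle\cdot,\cdot\rangle$ and norm $\|\cdot\|$, and let $A:D(A)\subset H\to H$ be a strictly positive selfadjoint linear operator whose domain is densely and compactly embedded in $H$. For $r\ge0$ set $H^r=D(A^{r/2})$, $\langle u,v\rangle_r=\langle A^{r/2}u,A^{r/2}v\rangle$, $\|u\|_r=\|A^{r/2}u\|$. All eigenvalues of $A$ are assumed simple; they form the increasing sequence $0<\lambda_1<\lambda_2<\cdots\to\infty$ ($n\in\mathbb{N}=\{1,2,3,\dots\}$), and the corresponding normalized eigenvectors $e_n$ form a complete orthonormal basis of $H$. Fix $\beta\in\mathbb{R}$ and $\varrho,k>0$. A (weak) solution of the system is a couple $(u,v)\in H^2\times H^2$ such that $$\langle u,\phi\rangle_2+C_u\langle u,\phi\rangle_1+k\langle u-v,\phi\rangle=0,\qquad \langle v,\psi\rangle_2+C_v\langle v,\psi\rangle_1-k\langle u-v,\psi\rangle=0$$ for every $(\phi,\psi)\in H^2\times H^2$. A solution is bimodal, involving $e_{n_1}$ and $e_{n_2}$ ($n_1\ne n_2$), if $u=\alpha_{n_1}e_{n_1}+\alpha_{n_2}e_{n_2}$ and $v=\gamma_{n_1}e_{n_1}+\gamma_{n_2}e_{n_2}$ with all of $\alpha_{n_1},\alpha_{n_2},\gamma_{n_1},\gamma_{n_2}$ nonzero reals. It is of not equidistributed energy if $\|u\|_1\ne\|v\|_1$ (equivalently $C_u\neq C_v$). For $n_1<n_2$ define (depending on $(n_1,n_2)$) $\zeta=\lambda_{n_2}/\lambda_{n_1}>1$,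 $\sigma=(k-\lambda_{n_1}\lambda_{n_2})/k$, and, whenever $\sigma\ne0$, $$\Phi=\frac{(\zeta+1)+(\zeta-1)\sigma^2}{\sigma\zeta},\qquad \Psi=\frac{(\zeta+1)-(\zeta-1)\sigma^2}{\sigma}.$$ Whenever real, set $$X=\frac{\Phi+\sqrt{\Phi^2-4}}2,\quad Y=\frac{\Phi-\sqrt{\Phi^2-4}}2,\quad W=\frac{\Psi+\sqrt{\Psi^2-4}}2,\quad Z=\frac{\Psi-\sqrt{\Psi^2-4}}2,$$ $$f=\frac{kX-\lambda_{n_1}^2-k}{\lambda_{n_1}},\qquad g=\frac{kY-\lambda_{n_1}^2-k}{\lambda_{n_1}}.$$ (These are real for $(n_1,n_2)\in\mathbb{B}^\star$.) For $\sigma\neq0$ set $$\mathfrak m=\frac{k^2+k\lambda_{n_2}(\lambda_{n_2}-\lambda_{n_1})+\lambda_{n_1}^2\lambda_{n_2}^2}{(\lambda_{n_1}\lambda_{n_2}-k)\lambda_{n_2}},\qquad \mathfrak M=\frac{k^2-k\lambda_{n_1}(\lambda_{n_2}-\lambda_{n_1})+\lambda_{n_1}^2\lambda_{n_2}^2}{(\lambda_{n_1}\lambda_{n_2}-k)\lambda_{n_1}}.$$ Finally let $$\mathbb{B}_1^\star=\{(n_1,n_2)\in\mathbb{N}^2:n_1<n_2,\ \mathfrak m<-\beta<\mathfrak M\ \text{and}\ \lambda_{n_1}\lambda_{n_2}\in(k,2k)\},$$ $$\mathbb{B}_2^\star=\{(n_1,n_2)\in\mathbb{N}^2:n_1<n_2,\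 \mathfrak M<-\beta\ \text{and}\ \lambda_{n_1}(\lambda_{n_2}-\lambda_{n_1})\in(2k,\infty)\},$$ $\mathbb{B}^\star=\mathbb{B}_1^\star\cup\mathbb{B}_2^\star$, with $|\mathbb{B}^\star|$ its cardinality. *)

theory Defs
  imports "HOL-Analysis.Analysis"
begin

section \<open>The operator\<close>

text \<open>
  An unbounded operator on \<open>H\<close> is a pair of its domain \<open>D\<close> and a function \<open>A\<close> whose values
  outside \<open>D\<close> are irrelevant. The last conjunct says that the graph of the adjoint of \<open>A\<close>
  is the graph of \<open>A\<close>.
\<close>

definition selfadjoint_op :: "'a::real_inner set \<Rightarrow> ('a \<Rightarrow> 'a) \<Rightarrow> bool" where
  "selfadjoint_op D A \<longleftrightarrow>
     subspace D \<and> closure D = UNIV \<and>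
     (\<forall>x\<in>D. \<forall>y\<in>D. A (x + y) = A x + A y) \<and>
     (\<forall>c. \<forall>x\<in>D. A (c *\<^sub>R x) = c *\<^sub>R A x) \<and>
     (\<forall>y z. (\<forall>x\<in>D. inner (A x) y = inner x z) \<longleftrightarrow> y \<in> D \<and> z = A y)"

definition strictly_positive_op :: "'a::real_inner set \<Rightarrow> ('a \<Rightarrow> 'a) \<Rightarrow> bool" where
  "strictly_positive_op D A \<longleftrightarrow> (\<forall>x\<in>D. x \<noteq> 0 \<longrightarrow> inner (A x) x > 0)"

text \<open>Subsets of the domain that are bounded in the graph norm are relatively compact in \<open>H\<close>.\<close>

definition compactly_embedded_domain :: "'a::real_inner set \<Rightarrow> ('a \<Rightarrow> 'a) \<Rightarrow> bool" where
  "compactly_embedded_domain D A \<longleftrightarrow>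
     (\<forall>S c. S \<subseteq> D \<and> (\<forall>x\<in>S. sqrt ((norm x)\<^sup>2 + (norm (A x))\<^sup>2) \<le> c) \<longrightarrow> compact (closure S))"

definition eigenspace :: "'a::real_inner set \<Rightarrow> ('a \<Rightarrow> 'a) \<Rightarrow> real \<Rightarrow> 'a set" where
  "eigenspace D A \<mu> = {x \<in> D. A x = \<mu> *\<^sub>R x}"

definition eigenvalues :: "'a::real_inner set \<Rightarrow> ('a \<Rightarrow> 'a) \<Rightarrow> real set" where
  "eigenvalues D A = {\<mu>. \<exists>x. x \<noteq> 0 \<and> x \<in> eigenspace D A \<mu>}"

text \<open>
  The sequences \<open>lam\<close> and \<open>e\<close> are indexed from \<open>1\<close>; \<open>lam 0\<close> and \<open>e 0\<close> are unconstrained and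
  never used.
\<close>

definition simple_spectral_data ::
    "'a::real_inner set \<Rightarrow> ('a \<Rightarrow> 'a) \<Rightarrow> (nat \<Rightarrow> real) \<Rightarrow> (nat \<Rightarrow> 'a) \<Rightarrow> bool" where
  "simple_spectral_data D A lam e \<longleftrightarrow>
     (\<forall>\<mu>\<in>eigenvalues D A. dim (eigenspace D A \<mu>) = 1) \<and>
     eigenvalues D A = lam ` {1..} \<and>
     (\<forall>n\<ge>1. 0 < lam n) \<and> strict_mono_on {1..} lam \<and> filterlim lam at_top sequentially \<and>
     (\<forall>n\<ge>1. e n \<in> eigenspace D A (lam n)) \<and>
     (\<forall>m\<ge>1. \<forall>n\<ge>1. inner (e m) (e n) = (if m = n then 1 else 0)) \<and>
     closure (span (e ` {1..})) = UNIV"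

section \<open>The scale of spaces\<close>

text \<open>
  Fractional powers of \<open>A\<close> by the spectral calculus:
  \<open>x\<close> belongs to the domain of \<open>A\<^sup>s\<close> iff \<open>\<Sum>\<^sub>n \<lambda>\<^sub>n\<^sup>2\<^sup>s \<langle>x, e\<^sub>n\<rangle>\<^sup>2 < \<infinity>\<close>, and then
  \<open>A\<^sup>s x = \<Sum>\<^sub>n \<lambda>\<^sub>n\<^sup>s \<langle>x, e\<^sub>n\<rangle> e\<^sub>n\<close>. The lemmas \<open>dom_pow_one\<close>, \<open>op_pow_one\<close> and \<open>op_pow_add\<close> below
  show that the power \<open>1\<close> is \<open>A\<close> itself and that powers add up, so that the power \<open>1/2\<close> is
  a square root of \<open>A\<close>.
\<close>

definition dom_pow :: "(nat \<Rightarrow> real) \<Rightarrow> (nat \<Rightarrow> 'a::real_inner) \<Rightarrow> real \<Rightarrow> 'a set" where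
  "dom_pow lam e s = {x. (\<lambda>n. (lam n powr s * inner x (e n))\<^sup>2) summable_on {1..}}"

definition op_pow :: "(nat \<Rightarrow> real) \<Rightarrow> (nat \<Rightarrow> 'a::real_inner) \<Rightarrow> real \<Rightarrow> 'a \<Rightarrow> 'a" where
  "op_pow lam e s x = (\<Sum>\<^sub>\<infinity>n\<in>{1..}. (lam n powr s * inner x (e n)) *\<^sub>R e n)"

definition Hsp :: "(nat \<Rightarrow> real) \<Rightarrow> (nat \<Rightarrow> 'a::real_inner) \<Rightarrow> real \<Rightarrow> 'a set" where
  "Hsp lam e r = dom_pow lam e (r / 2)"

definition Hinner :: "(nat \<Rightarrow> real) \<Rightarrow> (nat \<Rightarrow> 'a::real_inner) \<Rightarrow> real \<Rightarrow> 'a \<Rightarrow> 'a \<Rightarrow> real" where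
  "Hinner lam e r u v = inner (op_pow lam e (r / 2) u) (op_pow lam e (r / 2) v)"

definition Hnorm :: "(nat \<Rightarrow> real) \<Rightarrow> (nat \<Rightarrow> 'a::real_inner) \<Rightarrow> real \<Rightarrow> 'a \<Rightarrow> real" where
  "Hnorm lam e r u = norm (op_pow lam e (r / 2) u)"

lemma orthonormal_sum_inner:
  fixes e :: "nat \<Rightarrow> 'a::real_inner"
  assumes "\<forall>m\<ge>1. \<forall>n\<ge>1. inner (e m) (e n) = (if m = n then 1 else 0)"
    and "finite F" "F \<subseteq> {1..}"
  shows "inner (\<Sum>n\<in>F. a n *\<^sub>R e n) (\<Sum>n\<in>F. b n *\<^sub>R e n) = (\<Sum>n\<in>F. a n * b n)"
proof -
  have "inner (\<Sum>n\<in>F. a n *\<^sub>R e n) (\<Sum>n\<in>F. b n *\<^sub>R e n)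
      = (\<Sum>n\<in>F. \<Sum>m\<in>F. a m * (b n * inner (e m) (e n)))"
    by (simp add: inner_sum_left inner_sum_right sum_distrib_left mult_ac)
  also have "\<dots> = (\<Sum>n\<in>F. \<Sum>m\<in>F. if m = n then a m * b n else 0)"
    by (intro sum.cong refl) (use assms in \<open>auto simp: subset_iff\<close>)
  also have "\<dots> = (\<Sum>n\<in>F. a n * b n)"
    using assms(2) by simp
  finally show ?thesis .
qed

lemma orthonormal_square_summable:
  fixes e :: "nat \<Rightarrow> 'a::{real_inner,complete_space}"
  assumes on: "\<forall>m\<ge>1. \<forall>n\<ge>1. inner (e m) (e n) = (if m = n then 1 else 0)"
    and sq: "(\<lambda>n. (a n)\<^sup>2) summable_on {1..}"
  shows "(\<lambda>n. a n *\<^sub>R e n) summable_on {1..}"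
proof -
  let ?s = "\<lambda>F. \<Sum>n\<in>F. a n *\<^sub>R e n"
  have nrm: "(norm (?s F))\<^sup>2 = (\<Sum>n\<in>F. (a n)\<^sup>2)" if "finite F" "F \<subseteq> {1..}" for F
    unfolding power2_norm_eq_inner orthonormal_sum_inner[OF on that] by (simp add: power2_eq_square)
  have ev: "\<exists>P. eventually P (finite_subsets_at_top {1..}) \<and>
              (\<forall>F G. P F \<and> P G \<longrightarrow> dist (?s F) (?s G) < d)" if "d > 0" for d
  proof -
    define \<epsilon> where "\<epsilon> = (d/2)\<^sup>2 / 2"
    have "\<epsilon> > 0" using that by (simp add: \<epsilon>_def)
    obtain F0 where F0: "finite F0" "F0 \<subseteq> {1..}"
      "dist (\<Sum>n\<in>F0. (a n)\<^sup>2) (\<Sum>\<^sub>\<infinity>n\<in>{1..}. (a n)\<^sup>2) \<le> \<epsilon>"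
      using infsum_finite_approximation[OF sq \<open>\<epsilon> > 0\<close>] by blast
    have close: "dist (?s F) (?s F0) < d / 2" if F: "finite F" "F0 \<subseteq> F" "F \<subseteq> {1..}" for F
    proof -
      have "?s F - ?s F0 = ?s (F - F0)"
        using F by (simp add: sum_diff)
      then have "(dist (?s F) (?s F0))\<^sup>2 = (\<Sum>n\<in>F - F0. (a n)\<^sup>2)"
        using nrm[of "F - F0"] F by (auto simp: dist_norm)
      also have "\<dots> = (\<Sum>n\<in>F. (a n)\<^sup>2) - (\<Sum>n\<in>F0. (a n)\<^sup>2)"
        using F by (simp add: sum_diff)
      also have "\<dots> \<le> (\<Sum>\<^sub>\<infinity>n\<in>{1..}. (a n)\<^sup>2) - (\<Sum>n\<in>F0. (a n)\<^sup>2)"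
        using finite_sum_le_infsum[OF sq F(1) F(3)] by simp
      also have "\<dots> \<le> \<epsilon>"
        using F0(3) by (simp add: dist_real_def)
      also have "\<dots> < (d/2)\<^sup>2"
        using that \<open>d > 0\<close> by (simp add: \<epsilon>_def)
      finally show ?thesis
        by (rule power2_less_imp_less) (use \<open>d > 0\<close> in simp)
    qed
    have "eventually (\<lambda>F. finite F \<and> F0 \<subseteq> F \<and> F \<subseteq> {1..}) (finite_subsets_at_top {1..})"
      unfolding eventually_finite_subsets_at_top using F0 by blast
    moreover have "dist (?s F) (?s G) < d"
      if "finite F \<and> F0 \<subseteq> F \<and> F \<subseteq> {1..}" "finite G \<and> F0 \<subseteq> G \<and> G \<subseteq> {1..}" for F G
    proof -
      have "dist (?s F) (?s F0) < d / 2" "dist (?s G) (?s F0) < d / 2"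
        using close that by blast+
      then show ?thesis
        using dist_triangle2[of "?s F" "?s G" "?s F0"] by linarith
    qed
    ultimately show ?thesis
      by (intro exI[of _ "\<lambda>F. finite F \<and> F0 \<subseteq> F \<and> F \<subseteq> {1..}"] conjI allI impI)
        (assumption, elim conjE, blast)
  qed
  have "cauchy_filter (filtermap ?s (finite_subsets_at_top {1..}))"
    unfolding cauchy_filter_metric_filtermap using ev by blast
  moreover have "complete (UNIV :: 'a set)"
    by (meson Cauchy_convergent UNIV_I complete_def convergent_def)
  ultimately obtain L where "(?s \<longlongrightarrow> L) (finite_subsets_at_top {1..})"
    using complete_uniform[where S=UNIV] by (force simp add: filterlim_def)
  then show ?thesis
    using summable_on_def has_sum_def by blast
qed

lemma orthonormal_bessel:
  fixes e :: "nat \<Rightarrow> 'a::real_inner"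
  assumes on: "\<forall>m\<ge>1. \<forall>n\<ge>1. inner (e m) (e n) = (if m = n then 1 else 0)"
  shows "(\<lambda>n. (inner x (e n))\<^sup>2) summable_on {1..}"
proof (rule nonneg_bdd_above_summable_on)
  have "(\<Sum>n\<in>F. (inner x (e n))\<^sup>2) \<le> (norm x)\<^sup>2" if "finite F" "F \<subseteq> {1..}" for F
  proof -
    define y where "y = (\<Sum>n\<in>F. inner x (e n) *\<^sub>R e n)"
    have yy: "inner y y = (\<Sum>n\<in>F. (inner x (e n))\<^sup>2)"
      unfolding y_def orthonormal_sum_inner[OF on that] by (simp add: power2_eq_square)
    have xy: "inner x y = (\<Sum>n\<in>F. (inner x (e n))\<^sup>2)"
      unfolding y_def by (simp add: inner_sum_right power2_eq_square)
    have "0 \<le> inner (x - y) (x - y)" by simp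
    also have "\<dots> = (norm x)\<^sup>2 - (\<Sum>n\<in>F. (inner x (e n))\<^sup>2)"
      using xy yy by (simp add: inner_diff_left inner_diff_right inner_commute power2_norm_eq_inner)
    finally show ?thesis by simp
  qed
  then show "bdd_above (sum (\<lambda>n. (inner x (e n))\<^sup>2) ` {F. F \<subseteq> {1..} \<and> finite F})"
    by (auto intro!: bdd_aboveI)
qed auto

lemma orthonormal_total_zero:
  fixes e :: "nat \<Rightarrow> 'a::real_inner"
  assumes "closure (span (e ` {1..})) = UNIV" and z: "\<And>n. n \<ge> 1 \<Longrightarrow> inner x (e n) = 0"
  shows "x = 0"
proof -
  have "span (e ` {1..}) \<subseteq> {y. inner x y = 0}"
    by (rule span_minimal) (use z in \<open>auto simp: subspace_def inner_add_right\<close>)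
  moreover have "closed {y. inner x y = 0}"
    by (intro closed_Collect_eq continuous_intros)
  ultimately have "closure (span (e ` {1..})) \<subseteq> {y. inner x y = 0}"
    by (rule closure_minimal)
  then show ?thesis
    using assms(1) by (auto dest: subsetD[of UNIV _ x])
qed

context
  fixes D :: "'a::{real_inner,complete_space} set" and A lam e
  assumes sa: "selfadjoint_op D A" and sd: "simple_spectral_data D A lam e"
begin

private lemma on: "\<forall>m\<ge>1. \<forall>n\<ge>1. inner (e m) (e n) = (if m = n then 1 else 0)"
  using sd by (simp add: simple_spectral_data_def)

lemma op_pow_has_sum:
  assumes "x \<in> dom_pow lam e s"
  shows "((\<lambda>n. (lam n powr s * inner x (e n)) *\<^sub>R e n) has_sum op_pow lam e s x) {1..}"
  unfolding op_pow_def
  by (intro has_sum_infsum orthonormal_square_summable[OF on]) (use assms in \<open>simp add: dom_pow_def\<close>)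

lemma inner_op_pow:
  assumes "x \<in> dom_pow lam e s" "n \<ge> 1"
  shows "inner (op_pow lam e s x) (e n) = lam n powr s * inner x (e n)"
proof -
  have "((\<lambda>m. inner ((lam m powr s * inner x (e m)) *\<^sub>R e m) (e n))
          has_sum inner (op_pow lam e s x) (e n)) {1..}"
    by (rule has_sum_bounded_linear[OF bounded_linear_inner_left op_pow_has_sum[OF assms(1)]])
  moreover have "((\<lambda>m. inner ((lam m powr s * inner x (e m)) *\<^sub>R e m) (e n))
          has_sum (lam n powr s * inner x (e n))) {1..}"
  proof (rule has_sum_finite_neutralI[of "{n}"])
    show "inner ((lam m powr s * inner x (e m)) *\<^sub>R e m) (e n) = 0" if "m \<in> {1..} - {n}" for m
      using that assms(2) on by auto
  qed (use assms(2) on in auto)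
  ultimately show ?thesis
    by (rule has_sum_unique)
qed

lemma inner_A_e:
  assumes "x \<in> D" "n \<ge> 1"
  shows "inner (A x) (e n) = lam n * inner x (e n)"
proof -
  have "e n \<in> D" "A (e n) = lam n *\<^sub>R e n"
    using sd assms(2) by (auto simp: simple_spectral_data_def eigenspace_def)
  moreover have "inner (A x) (e n) = inner x (A (e n))"
    using sa assms(1) \<open>e n \<in> D\<close> unfolding selfadjoint_op_def by blast
  ultimately show ?thesis by simp
qed

private lemma lam_pos: "n \<ge> 1 \<Longrightarrow> lam n > 0"
  using sd by (simp add: simple_spectral_data_def)

private lemma lam_powr_one: "n \<ge> 1 \<Longrightarrow> lam n powr 1 = lam n"
  using lam_pos[of n] by simp

private lemma lam_powr_zero: "n \<ge> 1 \<Longrightarrow> lam n powr 0 = 1"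
  using lam_pos[of n] by simp

private lemma total_eqI: "(\<And>n. n \<ge> 1 \<Longrightarrow> inner x (e n) = inner y (e n)) \<Longrightarrow> x = y"
  using orthonormal_total_zero[of e "x - y"] sd
  by (auto simp: simple_spectral_data_def inner_diff_left)

lemma dom_pow_one: "dom_pow lam e 1 = D"
proof
  show "D \<subseteq> dom_pow lam e 1"
  proof
    fix x assume x: "x \<in> D"
    have "(\<lambda>n. (inner (A x) (e n))\<^sup>2) summable_on {1..}"
      by (rule orthonormal_bessel[OF on])
    then show "x \<in> dom_pow lam e 1"
      unfolding dom_pow_def mem_Collect_eq
      by (subst summable_on_cong[where g = "\<lambda>n. (inner (A x) (e n))\<^sup>2"])
         (use inner_A_e[OF x] lam_powr_one in auto)
  qed
next
  show "dom_pow lam e 1 \<subseteq> D"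
  proof
    fix x assume x: "x \<in> dom_pow lam e 1"
    define z where "z = op_pow lam e 1 x"
    have "inner (A y) x = inner y z" if y: "y \<in> D" for y
    proof -
      have x0: "x \<in> dom_pow lam e 0"
      proof -
        have "(\<lambda>n. (inner x (e n))\<^sup>2) summable_on {1..}"
          by (rule orthonormal_bessel[OF on])
        then show ?thesis
          unfolding dom_pow_def mem_Collect_eq
          by (subst summable_on_cong[where g = "\<lambda>n. (inner x (e n))\<^sup>2"])
             (simp_all add: lam_powr_zero del: powr_zero_eq_one)
      qed
      have xid: "op_pow lam e 0 x = x"
        by (rule total_eqI) (simp add: inner_op_pow[OF x0] lam_powr_zero del: powr_zero_eq_one)
      have "((\<lambda>n. inner (A y) ((lam n powr 0 * inner x (e n)) *\<^sub>R e n)) has_sum inner (A y) x) {1..}"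
        using has_sum_bounded_linear[OF bounded_linear_inner_right op_pow_has_sum[OF x0], of "A y"]
        by (simp add: xid)
      moreover have "((\<lambda>n. inner y ((lam n powr 1 * inner x (e n)) *\<^sub>R e n)) has_sum inner y z) {1..}"
        unfolding z_def
        by (rule has_sum_bounded_linear[OF bounded_linear_inner_right op_pow_has_sum[OF x]])
      moreover have "inner (A y) ((lam n powr 0 * inner x (e n)) *\<^sub>R e n)
          = inner y ((lam n powr 1 * inner x (e n)) *\<^sub>R e n)" if "n \<in> {1..}" for n
        using that inner_A_e[OF y, of n] lam_powr_one[of n] lam_powr_zero[of n]
        by (simp del: powr_zero_eq_one powr_one powr_one_eq_one)
      ultimately show ?thesis
        using has_sum_unique has_sum_cong[of "{1..}"
          "\<lambda>n. inner (A y) ((lam n powr 0 * inner x (e n)) *\<^sub>R e n)"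
          "\<lambda>n. inner y ((lam n powr 1 * inner x (e n)) *\<^sub>R e n)"] by blast
    qed
    then show "x \<in> D"
      using sa unfolding selfadjoint_op_def by blast
  qed
qed

lemma op_pow_one:
  assumes "x \<in> D"
  shows "op_pow lam e 1 x = A x"
proof (rule total_eqI)
  fix n :: nat assume "n \<ge> 1"
  then show "inner (op_pow lam e 1 x) (e n) = inner (A x) (e n)"
    using inner_op_pow[of x 1 n] assms dom_pow_one inner_A_e lam_powr_one by simp
qed

lemma op_pow_add:
  assumes "x \<in> dom_pow lam e t" "x \<in> dom_pow lam e (s + t)"
  shows "op_pow lam e t x \<in> dom_pow lam e s"
    and "op_pow lam e s (op_pow lam e t x) = op_pow lam e (s + t) x"
proof -
  have eq: "lam n powr s * inner (op_pow lam e t x) (e n) = lam n powr (s + t) * inner x (e n)"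
    if "n \<ge> 1" for n
    using inner_op_pow[OF assms(1) that] by (simp add: powr_add)
  show dom: "op_pow lam e t x \<in> dom_pow lam e s"
    using assms(2) unfolding dom_pow_def mem_Collect_eq
    by (subst summable_on_cong[where g = "\<lambda>n. (lam n powr (s + t) * inner x (e n))\<^sup>2"])
       (use eq in auto)
  show "op_pow lam e s (op_pow lam e t x) = op_pow lam e (s + t) x"
    by (rule total_eqI) (simp add: inner_op_pow dom assms(2) eq)
qed

end

section \<open>Solutions of the system\<close>

definition weak_solution ::
    "(nat \<Rightarrow> real) \<Rightarrow> (nat \<Rightarrow> 'a::real_inner) \<Rightarrow> real \<Rightarrow> real \<Rightarrow> real \<Rightarrow> 'a \<Rightarrow> 'a \<Rightarrow> bool" where
  "weak_solution lam e \<beta> \<rho> k u v \<longleftrightarrow>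
     u \<in> Hsp lam e 2 \<and> v \<in> Hsp lam e 2 \<and>
     (let Cu = \<beta> + \<rho> * (Hnorm lam e 1 u)\<^sup>2; Cv = \<beta> + \<rho> * (Hnorm lam e 1 v)\<^sup>2 in
       \<forall>\<phi>\<in>Hsp lam e 2. \<forall>\<psi>\<in>Hsp lam e 2.
         Hinner lam e 2 u \<phi> + Cu * Hinner lam e 1 u \<phi> + k * inner (u - v) \<phi> = 0 \<and>
         Hinner lam e 2 v \<psi> + Cv * Hinner lam e 1 v \<psi> - k * inner (u - v) \<psi> = 0)"

definition bimodal :: "(nat \<Rightarrow> 'a::real_inner) \<Rightarrow> nat \<Rightarrow> nat \<Rightarrow> 'a \<Rightarrow> 'a \<Rightarrow> bool" where
  "bimodal e n1 n2 u v \<longleftrightarrow>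
     1 \<le> n1 \<and> 1 \<le> n2 \<and> n1 \<noteq> n2 \<and>
     (\<exists>\<alpha>1 \<alpha>2 \<gamma>1 \<gamma>2. \<alpha>1 \<noteq> 0 \<and> \<alpha>2 \<noteq> 0 \<and> \<gamma>1 \<noteq> 0 \<and> \<gamma>2 \<noteq> 0 \<and>
        u = \<alpha>1 *\<^sub>R e n1 + \<alpha>2 *\<^sub>R e n2 \<and> v = \<gamma>1 *\<^sub>R e n1 + \<gamma>2 *\<^sub>R e n2)"

text \<open>The bimodal solutions of not equidistributed energy involving \<open>e n1\<close> and \<open>e n2\<close>.\<close>

definition bimodal_NE_solutions ::
    "(nat \<Rightarrow> real) \<Rightarrow> (nat \<Rightarrow> 'a::real_inner) \<Rightarrow> real \<Rightarrow> real \<Rightarrow> real \<Rightarrow> nat \<Rightarrow> nat \<Rightarrow> ('a \<times> 'a) set" where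
  "bimodal_NE_solutions lam e \<beta> \<rho> k n1 n2 =
     {(u, v). weak_solution lam e \<beta> \<rho> k u v \<and> bimodal e n1 n2 u v \<and> Hnorm lam e 1 u \<noteq> Hnorm lam e 1 v}"

definition all_bimodal_NE_solutions ::
    "(nat \<Rightarrow> real) \<Rightarrow> (nat \<Rightarrow> 'a::real_inner) \<Rightarrow> real \<Rightarrow> real \<Rightarrow> real \<Rightarrow> ('a \<times> 'a) set" where
  "all_bimodal_NE_solutions lam e \<beta> \<rho> k = (\<Union>n1. \<Union>n2. bimodal_NE_solutions lam e \<beta> \<rho> k n1 n2)"

section \<open>The parameters attached to a pair of modes\<close>

definition zeta :: "(nat \<Rightarrow> real) \<Rightarrow> nat \<Rightarrow> nat \<Rightarrow> real" where
  "zeta lam n1 n2 = lam n2 / lam n1"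

definition sigmac :: "(nat \<Rightarrow> real) \<Rightarrow> real \<Rightarrow> nat \<Rightarrow> nat \<Rightarrow> real" where
  "sigmac lam k n1 n2 = (k - lam n1 * lam n2) / k"

definition Phi :: "(nat \<Rightarrow> real) \<Rightarrow> real \<Rightarrow> nat \<Rightarrow> nat \<Rightarrow> real" where
  "Phi lam k n1 n2 = (let \<zeta> = zeta lam n1 n2; \<sigma> = sigmac lam k n1 n2 in
     ((\<zeta> + 1) + (\<zeta> - 1) * \<sigma>\<^sup>2) / (\<sigma> * \<zeta>))"

definition Psi :: "(nat \<Rightarrow> real) \<Rightarrow> real \<Rightarrow> nat \<Rightarrow> nat \<Rightarrow> real" where
  "Psi lam k n1 n2 = (let \<zeta> = zeta lam n1 n2; \<sigma> = sigmac lam k n1 n2 in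
     ((\<zeta> + 1) - (\<zeta> - 1) * \<sigma>\<^sup>2) / \<sigma>)"

text \<open>
  \<open>sqrt\<close> is total in HOL. The square roots below have their intended meaning when
  \<open>Phi\<^sup>2 \<ge> 4\<close> and \<open>Psi\<^sup>2 \<ge> 4\<close>; that this is so for pairs in \<open>Bstar\<close> is part of the theorem.
\<close>

definition Xc :: "(nat \<Rightarrow> real) \<Rightarrow> real \<Rightarrow> nat \<Rightarrow> nat \<Rightarrow> real" where
  "Xc lam k n1 n2 = (Phi lam k n1 n2 + sqrt ((Phi lam k n1 n2)\<^sup>2 - 4)) / 2"

definition Yc :: "(nat \<Rightarrow> real) \<Rightarrow> real \<Rightarrow> nat \<Rightarrow> nat \<Rightarrow> real" where
  "Yc lam k n1 n2 = (Phi lam k n1 n2 - sqrt ((Phi lam k n1 n2)\<^sup>2 - 4)) / 2"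

definition Wc :: "(nat \<Rightarrow> real) \<Rightarrow> real \<Rightarrow> nat \<Rightarrow> nat \<Rightarrow> real" where
  "Wc lam k n1 n2 = (Psi lam k n1 n2 + sqrt ((Psi lam k n1 n2)\<^sup>2 - 4)) / 2"

definition Zc :: "(nat \<Rightarrow> real) \<Rightarrow> real \<Rightarrow> nat \<Rightarrow> nat \<Rightarrow> real" where
  "Zc lam k n1 n2 = (Psi lam k n1 n2 - sqrt ((Psi lam k n1 n2)\<^sup>2 - 4)) / 2"

definition fc :: "(nat \<Rightarrow> real) \<Rightarrow> real \<Rightarrow> nat \<Rightarrow> nat \<Rightarrow> real" where
  "fc lam k n1 n2 = (k * Xc lam k n1 n2 - (lam n1)\<^sup>2 - k) / lam n1"

definition gc :: "(nat \<Rightarrow> real) \<Rightarrow> real \<Rightarrow> nat \<Rightarrow> nat \<Rightarrow> real" where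
  "gc lam k n1 n2 = (k * Yc lam k n1 n2 - (lam n1)\<^sup>2 - k) / lam n1"

text \<open>
  The denominators vanish exactly when \<open>sigmac = 0\<close>, that is \<open>lam n1 * lam n2 = k\<close>; such pairs
  are excluded from \<open>B1star\<close> and \<open>B2star\<close> by the respective last conditions.
\<close>

definition m_low :: "(nat \<Rightarrow> real) \<Rightarrow> real \<Rightarrow> nat \<Rightarrow> nat \<Rightarrow> real" where
  "m_low lam k n1 n2 =
     (k\<^sup>2 + k * lam n2 * (lam n2 - lam n1) + (lam n1)\<^sup>2 * (lam n2)\<^sup>2) / ((lam n1 * lam n2 - k) * lam n2)"

definition M_up :: "(nat \<Rightarrow> real) \<Rightarrow> real \<Rightarrow> nat \<Rightarrow> nat \<Rightarrow> real" where
  "M_up lam k n1 n2 =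
     (k\<^sup>2 - k * lam n1 * (lam n2 - lam n1) + (lam n1)\<^sup>2 * (lam n2)\<^sup>2) / ((lam n1 * lam n2 - k) * lam n1)"

definition B1star :: "(nat \<Rightarrow> real) \<Rightarrow> real \<Rightarrow> real \<Rightarrow> (nat \<times> nat) set" where
  "B1star lam \<beta> k = {(n1, n2). 1 \<le> n1 \<and> n1 < n2 \<and>
     m_low lam k n1 n2 < - \<beta> \<and> - \<beta> < M_up lam k n1 n2 \<and> lam n1 * lam n2 \<in> {k<..<2 * k}}"

definition B2star :: "(nat \<Rightarrow> real) \<Rightarrow> real \<Rightarrow> real \<Rightarrow> (nat \<times> nat) set" where
  "B2star lam \<beta> k = {(n1, n2). 1 \<le> n1 \<and> n1 < n2 \<and>
     M_up lam k n1 n2 < - \<beta> \<and> lam n1 * (lam n2 - lam n1) \<in> {2 * k<..}}"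

definition Bstar :: "(nat \<Rightarrow> real) \<Rightarrow> real \<Rightarrow> real \<Rightarrow> (nat \<times> nat) set" where
  "Bstar lam \<beta> k = B1star lam \<beta> k \<union> B2star lam \<beta> k"

text \<open>
  The couples \<open>u = r e\<^sub>n\<^sub>1 + t e\<^sub>n\<^sub>2\<close>, \<open>v = r p e\<^sub>n\<^sub>1 + t q e\<^sub>n\<^sub>2\<close> where \<open>(r, t)\<close> solves
  \<open>\<rho> r\<^sup>2 \<lambda>\<^sub>n\<^sub>1 + \<rho> t\<^sup>2 \<lambda>\<^sub>n\<^sub>2 + \<beta> = a\<close> and \<open>\<rho> r\<^sup>2 \<lambda>\<^sub>n\<^sub>1 p\<^sup>2 + \<rho> t\<^sup>2 \<lambda>\<^sub>n\<^sub>2 q\<^sup>2 + \<beta> = b\<close>.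
\<close>

definition solution_family ::
    "(nat \<Rightarrow> real) \<Rightarrow> (nat \<Rightarrow> 'a::real_inner) \<Rightarrow> real \<Rightarrow> real \<Rightarrow> nat \<Rightarrow> nat \<Rightarrow>
     real \<Rightarrow> real \<Rightarrow> real \<Rightarrow> real \<Rightarrow> ('a \<times> 'a) set" where
  "solution_family lam e \<beta> \<rho> n1 n2 p q a b =
     {(u, v). \<exists>r t.
        u = r *\<^sub>R e n1 + t *\<^sub>R e n2 \<and> v = (r * p) *\<^sub>R e n1 + (t * q) *\<^sub>R e n2 \<and>
        \<rho> * r\<^sup>2 * lam n1 + \<rho> * t\<^sup>2 * lam n2 + \<beta> = a \<and>
        \<rho> * r\<^sup>2 * lam n1 * p\<^sup>2 + \<rho> * t\<^sup>2 * lam n2 * q\<^sup>2 + \<beta> = b}"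

end

theory Submission
  imports Defs
begin

text \<open>
  Writing \<open>p\<close> and \<open>q\<close> for the ratios of the coefficients of \<open>v\<close> to those of \<open>u\<close> in the two modes,
  the four scalar equations of a bimodal solution determine \<open>C\<^sub>u\<close> from either \<open>p\<close> or \<open>q\<close>, and
  \<open>C\<^sub>v\<close> from either \<open>1/p\<close> or \<open>1/q\<close>. Consistency gives \<open>\<zeta> p - q = \<zeta>/p - 1/q = (\<zeta> - 1) \<sigma>\<close>,
  hence \<open>p + 1/p = \<Phi>\<close> and \<open>q + 1/q = \<Psi>\<close>; for \<open>C\<^sub>u > C\<^sub>v\<close> this forces \<open>p = X\<close>, \<open>q = W\<close>,
  \<open>C\<^sub>u = f\<close>, \<open>C\<^sub>v = g\<close>, and the opposite case arises by exchanging \<open>u\<close> and \<open>v\<close>.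
  What remains is a linear system for \<open>x = \<rho> \<lambda>\<^sub>n\<^sub>1 r\<^sup>2\<close> and \<open>y = \<rho> \<lambda>\<^sub>n\<^sub>2 t\<^sup>2\<close>, equivalent to
  \<open>(X\<^sup>2 - W\<^sup>2) y = (1 - X\<^sup>2) (M + \<beta>)\<close> and \<open>(W\<^sup>2 - X\<^sup>2) x = (1 - W\<^sup>2) (m + \<beta>)\<close>. Since \<open>X\<close>, \<open>W\<close> lie
  beyond \<open>1\<close> if \<open>\<sigma> > 0\<close>, satisfy \<open>-1 < X < W < 0\<close> if \<open>-1 < \<sigma> < 0\<close>, and \<open>-1 < X < 0\<close>, \<open>W > 1\<close>
  if \<open>\<sigma> < -1\<close>, it has a positive solution exactly on \<open>Bstar\<close>. There the two signs of \<open>r\<close>, the two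
  signs of \<open>t\<close> and the exchange give eight solutions.
\<close>

section \<open>The algebra of a pair of modes\<close>

text \<open>Reciprocal numbers share their sign. The larger of two distinct ones lies above 1 if
  both are positive, and between -1 and 0 if both are negative, so the sign of the sum locates
  it.\<close>

lemma larger_root_bounds:
  fixes x y :: real
  assumes "x * y = 1" "y < x"
  shows "x + y > 0 \<Longrightarrow> x > 1" and "x + y < 0 \<Longrightarrow> -1 < x \<and> x < 0"
proof -
  have nz: "x \<noteq> 0" "y \<noteq> 0" using assms(1) by auto
  have same: "x > 0 \<longleftrightarrow> y > 0"
    using assms(1) by (metis zero_less_mult_iff zero_less_one not_less_iff_gr_or_eq)
  { assume "x + y > 0"
    then have "y > 0" using nz same by linarith
    show "x > 1"
    proof (rule ccontr)
      assume "\<not> x > 1"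
      then have "x * y \<le> 1 * y" using \<open>y > 0\<close> by (intro mult_right_mono) auto
      then show False using assms \<open>\<not> x > 1\<close> by linarith
    qed }
  { assume "x + y < 0"
    then have "x < 0" using nz same assms(2) by linarith
    moreover have "-1 < x"
    proof (rule ccontr)
      assume "\<not> -1 < x"
      then have "y < -1" using assms(2) by linarith
      then have "(- x) * (- y) > 1 * 1"
        using \<open>\<not> -1 < x\<close> \<open>x < 0\<close> by (intro mult_le_less_imp_less) auto
      then show False using assms(1) by simp
    qed
    ultimately show "-1 < x \<and> x < 0" by simp }
qed

lemma sq_less_one: "-1 < x \<Longrightarrow> x < 0 \<Longrightarrow> x\<^sup>2 < (1::real)"
  by (simp add: abs_square_less_1)

lemma sq_greater_one: "1 < x \<Longrightarrow> 1 < (x::real)\<^sup>2"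
  by (simp add: one_less_power)

text \<open>Only the two eigenvalues and \<open>k\<close> enter the algebra of the ratios, which is
  therefore kept apart from the Hilbert space.\<close>

locale mode_pair =
  fixes lam :: "nat \<Rightarrow> real" and n1 n2 :: nat and k :: real
  assumes lam_pos: "0 < lam n1" and lam_less: "lam n1 < lam n2" and k_pos: "0 < k"
begin

abbreviation "a \<equiv> lam n1"
abbreviation "b \<equiv> lam n2"
abbreviation "\<zeta> \<equiv> zeta lam n1 n2"
abbreviation "\<sigma> \<equiv> sigmac lam k n1 n2"
abbreviation "\<Phi> \<equiv> Phi lam k n1 n2"
abbreviation "\<Psi> \<equiv> Psi lam k n1 n2"
abbreviation "X \<equiv> Xc lam k n1 n2"
abbreviation "Y \<equiv> Yc lam k n1 n2"
abbreviation "W \<equiv> Wc lam k n1 n2"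
abbreviation "Z \<equiv> Zc lam k n1 n2"
abbreviation "f \<equiv> fc lam k n1 n2"
abbreviation "g \<equiv> gc lam k n1 n2"
abbreviation "m \<equiv> m_low lam k n1 n2"
abbreviation "M \<equiv> M_up lam k n1 n2"

section \<open>Relations among the parameters and the candidate ratios\<close>

lemma b_pos: "0 < b"
  using lam_pos lam_less by linarith

lemma zeta_gt_1: "\<zeta> > 1"
  using lam_pos lam_less by (simp add: zeta_def)

lemma b_eq: "b = \<zeta> * a"
  using lam_pos by (simp add: zeta_def)

lemma ab_eq: "a * b = k * (1 - \<sigma>)"
  using k_pos by (simp add: sigmac_def field_simps)

lemma sigmac_less_1: "\<sigma> < 1"
  using ab_eq lam_pos b_pos k_pos mult_pos_pos[of a b] by (simp add: sigmac_def field_simps)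

lemma Phi_eq: "\<sigma> \<noteq> 0 \<Longrightarrow> \<Phi> * (\<sigma> * \<zeta>) = (\<zeta> + 1) + (\<zeta> - 1) * \<sigma>\<^sup>2"
  using zeta_gt_1 by (simp add: Phi_def Let_def)

lemma Psi_eq: "\<sigma> \<noteq> 0 \<Longrightarrow> \<Psi> * \<sigma> = (\<zeta> + 1) - (\<zeta> - 1) * \<sigma>\<^sup>2"
  by (simp add: Psi_def Let_def)

text \<open>The map z -> \<open>\<zeta> * z - (\<zeta> - 1) * \<sigma>\<close>, which takes the
  ratio in the first mode to the ratio in the second, sends two numbers with sum
  \<open>\<Phi>\<close> to two numbers with sum \<open>\<Psi>\<close>.\<close>

lemma Psi_Phi: "\<sigma> \<noteq> 0 \<Longrightarrow> \<Psi> = \<zeta> * \<Phi> - 2 * (\<zeta> - 1) * \<sigma>"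
  using zeta_gt_1 by (simp add: Phi_def Psi_def Let_def field_simps power2_eq_square)

text \<open>The affine map between the ratios stretches differences by \<open>\<zeta>\<close>, hence
  discriminants by its square. The single condition \<open>\<Phi>\<^sup>2 > 4\<close> thus makes all
  four roots real.\<close>

lemma Psi_disc:
  assumes "\<sigma> \<noteq> 0"
  shows "\<Psi>\<^sup>2 - 4 = \<zeta>\<^sup>2 * (\<Phi>\<^sup>2 - 4)"
proof -
  have "\<Psi>\<^sup>2 - 4 - \<zeta>\<^sup>2 * (\<Phi>\<^sup>2 - 4)
      = 4 * (\<zeta> - 1) * ((\<zeta> + 1) + (\<zeta> - 1) * \<sigma>\<^sup>2 - \<Phi> * (\<sigma> * \<zeta>))"
    unfolding Psi_Phi[OF assms] by (simp add: algebra_simps power2_eq_square)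
  then show ?thesis
    unfolding Phi_eq[OF assms] by simp
qed

text \<open>\<open>X\<close>, \<open>Y\<close> are the roots of z^2 - \<open>\<Phi>\<close> z + 1
  and \<open>W\<close>, \<open>Z\<close> those of z^2 - \<open>\<Psi>\<close> z + 1. The affine map
  sends one pair to the other and preserves the order since \<open>\<zeta>\<close> is positive, so
  \<open>X\<close> goes with \<open>W\<close> and \<open>Y\<close> with \<open>Z\<close>.\<close>

lemma ratios:
  assumes s: "\<sigma> \<noteq> 0" and d: "\<Phi>\<^sup>2 > 4"
  shows X_add_Y: "X + Y = \<Phi>" and X_mult_Y: "X * Y = 1" and Y_less_X: "Y < X"
    and W_add_Z: "W + Z = \<Psi>" and W_mult_Z: "W * Z = 1" and Z_less_W: "Z < W"
    and W_eq: "W = \<zeta> * X - (\<zeta> - 1) * \<sigma>" and Z_eq: "Z = \<zeta> * Y - (\<zeta> - 1) * \<sigma>"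
proof -
  define r where "r = sqrt (\<Phi>\<^sup>2 - 4)"
  have r: "r > 0" "r\<^sup>2 = \<Phi>\<^sup>2 - 4"
    using d by (simp_all add: r_def)
  have r': "sqrt (\<Psi>\<^sup>2 - 4) = \<zeta> * r"
    unfolding Psi_disc[OF s] r_def using zeta_gt_1 by (simp add: real_sqrt_mult)
  have X: "X = (\<Phi> + r) / 2" and Y: "Y = (\<Phi> - r) / 2"
    by (simp_all add: Xc_def Yc_def r_def)
  have W: "W = (\<Psi> + \<zeta> * r) / 2" and Z: "Z = (\<Psi> - \<zeta> * r) / 2"
    by (simp_all add: Wc_def Zc_def r')
  show "X + Y = \<Phi>" "Y < X" "W + Z = \<Psi>"
    using r by (simp_all add: X Y W Z field_simps)
  show "Z < W"
    using r zeta_gt_1 by (simp add: W Z)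
  show "X * Y = 1"
    using r by (simp add: X Y field_simps power2_eq_square)
  have "(\<zeta> * r)\<^sup>2 = \<Psi>\<^sup>2 - 4"
    by (simp add: power_mult_distrib r(2) Psi_disc[OF s])
  then show "W * Z = 1"
    by (simp add: W Z field_simps power2_eq_square)
  show "W = \<zeta> * X - (\<zeta> - 1) * \<sigma>" "Z = \<zeta> * Y - (\<zeta> - 1) * \<sigma>"
    unfolding X Y W Z Psi_Phi[OF s] by (simp_all add: field_simps)
qed

text \<open>The two relations express \<open>q\<close> and \<open>1 / q\<close> by \<open>p\<close>
  and \<open>1 / p\<close>; multiplying them eliminates \<open>q\<close> and leaves a linear
  equation for \<open>p + 1 / p\<close>. The inequality \<open>1 / p < p\<close> then selects the
  larger root.\<close>

lemma ratios_unique: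
  assumes pq: "p \<noteq> 0" "q \<noteq> 0" and eq1: "b * p - a * q = (b - a) * \<sigma>"
    and eq2: "b / p - a / q = (b - a) * \<sigma>" and gt: "1 / p < p"
  shows "\<sigma> \<noteq> 0" "\<Phi>\<^sup>2 > 4" "p = X" "1 / p = Y" "q = W" "1 / q = Z"
proof -
  have e1: "\<zeta> * p - q = (\<zeta> - 1) * \<sigma>" and e2: "\<zeta> * (1/p) - 1/q = (\<zeta> - 1) * \<sigma>"
    using eq1 eq2 lam_pos by (simp_all add: zeta_def field_simps)
  define p' q' where "p' = 1 / p" "q' = 1 / q"
  have inv: "p * p' = 1" "q * q' = 1"
    using pq by (simp_all add: p'_q'_def)
  have q: "q = \<zeta> * p - (\<zeta> - 1) * \<sigma>" "q' = \<zeta> * p' - (\<zeta> - 1) * \<sigma>"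
    using e1 e2 by (simp_all add: p'_q'_def)
  have "q * q' = \<zeta>\<^sup>2 * (p * p') - \<zeta> * (\<zeta> - 1) * \<sigma> * (p + p') + ((\<zeta> - 1) * \<sigma>)\<^sup>2"
    unfolding q by (simp add: algebra_simps power2_eq_square)
  then have "(\<zeta> - 1) * ((p + p') * (\<sigma> * \<zeta>)) = (\<zeta> - 1) * ((\<zeta> + 1) + (\<zeta> - 1) * \<sigma>\<^sup>2)"
    unfolding inv by (simp add: algebra_simps power2_eq_square)
  then have key: "(p + p') * (\<sigma> * \<zeta>) = (\<zeta> + 1) + (\<zeta> - 1) * \<sigma>\<^sup>2"
    using zeta_gt_1 by simp
  \<comment> \<open>With \<open>\<sigma>\<close> zero, \<open>key\<close> would read 0 =
    \<open>\<zeta> + 1\<close>.\<close>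
  show s: "\<sigma> \<noteq> 0"
    using key zeta_gt_1 by auto
  have sum: "p + p' = \<Phi>"
    using key Phi_eq[OF s] s zeta_gt_1 by (metis mult_right_cancel mult_eq_0_iff not_one_less_zero)
  have disc: "\<Phi>\<^sup>2 - 4 = (p - p')\<^sup>2"
    using inv sum[symmetric] by (simp add: algebra_simps power2_eq_square)
  have pp: "p' < p"
    using gt by (simp add: p'_q'_def)
  have "(p - p')\<^sup>2 > 0"
    using pp by simp
  then show d: "\<Phi>\<^sup>2 > 4"
    using disc by linarith
  have "sqrt (\<Phi>\<^sup>2 - 4) = p - p'"
    using pp by (simp add: disc)
  then show pX: "p = X" and pY: "1 / p = Y"
    using sum by (simp_all add: Xc_def Yc_def p'_q'_def field_simps)
  show "q = W" "1 / q = Z"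
    using q W_eq[OF s d] Z_eq[OF s d] unfolding p'_q'_def pY by (simp_all only: pX)
qed

section \<open>Energies and thresholds in terms of the ratios\<close>

lemma f_eq_2: "\<sigma> \<noteq> 0 \<Longrightarrow> \<Phi>\<^sup>2 > 4 \<Longrightarrow> f = (k * W - b\<^sup>2 - k) / b"
  and g_eq_2: "\<sigma> \<noteq> 0 \<Longrightarrow> \<Phi>\<^sup>2 > 4 \<Longrightarrow> g = (k * Z - b\<^sup>2 - k) / b"
proof -
  \<comment> \<open>The affine map multiplies the numerator by \<open>\<zeta>\<close>, as passing
    from \<open>a\<close> to \<open>b\<close> does with the denominator. Hence both modes give the
    same value of each energy coefficient.\<close>
  have *: "(k * x - a\<^sup>2 - k) / a = (k * (\<zeta> * x - (\<zeta> - 1) * \<sigma>) - b\<^sup>2 - k) / b" for x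
  proof -
    have s: "k * \<sigma> = k - a * b"
      using ab_eq by (simp add: algebra_simps)
    have "k * (\<zeta> * x - (\<zeta> - 1) * \<sigma>) - b\<^sup>2 - k = k * \<zeta> * x - (\<zeta> - 1) * (k * \<sigma>) - b\<^sup>2 - k"
      by (simp add: algebra_simps)
    also have "\<dots> = \<zeta> * (k * x - a\<^sup>2 - k)"
      unfolding s b_eq by (simp add: algebra_simps power2_eq_square)
    finally show ?thesis
      using lam_pos zeta_gt_1 by (simp add: b_eq)
  qed
  show "\<sigma> \<noteq> 0 \<Longrightarrow> \<Phi>\<^sup>2 > 4 \<Longrightarrow> f = (k * W - b\<^sup>2 - k) / b"
    "\<sigma> \<noteq> 0 \<Longrightarrow> \<Phi>\<^sup>2 > 4 \<Longrightarrow> g = (k * Z - b\<^sup>2 - k) / b"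
    by (simp_all add: fc_def gc_def * W_eq Z_eq)
qed

lemma g_less_f: "\<sigma> \<noteq> 0 \<Longrightarrow> \<Phi>\<^sup>2 > 4 \<Longrightarrow> g < f"
  using Y_less_X lam_pos k_pos by (simp add: fc_def gc_def divide_less_cancel)

text \<open>The rational expression defining the threshold is traded for one in
  \<open>\<Phi>\<close>, the form in which it emerges from the energy equations. The factor
  \<open>\<zeta>\<close> in the denominator of \<open>\<Phi>\<close> brings in an extra
  \<open>b\<close>, cancelled at the end.\<close>

lemma M_up_eq:
  assumes "\<sigma> \<noteq> 0"
  shows "M = (a\<^sup>2 + k - k * \<Phi>) / a"
proof -
  have nz: "a * b - k \<noteq> 0"
    using assms k_pos by (auto simp: sigmac_def)
  have s: "k * \<sigma> = k - a * b"
    using ab_eq by (simp add: algebra_simps)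
  have z: "(\<zeta> - 1) * a = b - a"
    by (simp add: b_eq algebra_simps)
  have "k * \<Phi> * (k * \<sigma>) * b = k\<^sup>2 * (\<Phi> * (\<sigma> * \<zeta>)) * a"
    by (simp add: b_eq power2_eq_square)
  also have "\<dots> = k\<^sup>2 * ((\<zeta> - 1) * a) + 2 * k\<^sup>2 * a + ((\<zeta> - 1) * a) * (k * \<sigma>)\<^sup>2"
    unfolding Phi_eq[OF assms] by (simp add: algebra_simps power2_eq_square)
  finally have "(a\<^sup>2 + k - k * \<Phi>) * (a * b - k) * b
      = (k\<^sup>2 - k * a * (b - a) + a\<^sup>2 * b\<^sup>2) * b"
    unfolding s z by (simp add: algebra_simps power2_eq_square)
  then have "(a\<^sup>2 + k - k * \<Phi>) * (a * b - k) = k\<^sup>2 - k * a * (b - a) + a\<^sup>2 * b\<^sup>2"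
    using b_pos by simp
  then show ?thesis
    unfolding M_up_def using nz lam_pos by (simp add: divide_simps mult_ac)
qed

lemma m_low_eq:
  assumes "\<sigma> \<noteq> 0"
  shows "m = (b\<^sup>2 + k - k * \<Psi>) / b"
proof -
  have nz: "a * b - k \<noteq> 0"
    using assms k_pos by (auto simp: sigmac_def)
  have s: "k * \<sigma> = k - a * b"
    using ab_eq by (simp add: algebra_simps)
  have z: "(\<zeta> - 1) * a = b - a"
    by (simp add: b_eq algebra_simps)
  have "k * \<Psi> * (k * \<sigma>) = k\<^sup>2 * (\<Psi> * \<sigma>)"
    by (simp add: power2_eq_square)
  also have "\<dots> = k\<^sup>2 * (\<zeta> + 1) - (\<zeta> - 1) * (k * \<sigma>)\<^sup>2"
    unfolding Psi_eq[OF assms] by (simp add: algebra_simps power2_eq_square)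
  also have "\<dots> = 2 * k\<^sup>2 + 2 * k * b * ((\<zeta> - 1) * a) - ((\<zeta> - 1) * a) * a * b\<^sup>2"
    unfolding s by (simp add: algebra_simps power2_eq_square)
  finally have "(b\<^sup>2 + k - k * \<Psi>) * (a * b - k) = k\<^sup>2 + k * b * (b - a) + a\<^sup>2 * b\<^sup>2"
    unfolding s z by (simp add: algebra_simps power2_eq_square)
  then show ?thesis
    unfolding m_low_def using nz b_pos by (simp add: divide_simps mult_ac)
qed

text \<open>For negative \<open>\<sigma>\<close> a bound \<open>M < -\<beta>\<close> therefore
  includes \<open>m < -\<beta>\<close>, which is how the single inequality in \<open>B2star\<close>
  controls both unknowns.\<close>

lemma m_low_less_M_up:
  assumes "\<sigma> < 0"
  shows "m < M"
proof -
  have pos: "a * b - k > 0"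
    using assms k_pos by (simp add: sigmac_def divide_less_0_iff)
  have "M - m = (b - a) * (a * b - k) / (a * b)"
    unfolding M_up_def m_low_def using pos lam_pos b_pos
    by (simp add: divide_simps) (simp add: algebra_simps power2_eq_square)
  also have "\<dots> > 0"
    using pos lam_pos b_pos lam_less by simp
  finally show ?thesis by simp
qed

text \<open>The left side is what remains of the energy equations when the first mode is eliminated.
  By \<open>X * Y = 1\<close> the term \<open>X\<^sup>2 * Y\<close> collapses to \<open>X\<close>,
  and the factor \<open>1 - X\<^sup>2\<close> splits off.\<close>

lemma M_up_identity:
  assumes "\<sigma> \<noteq> 0" "\<Phi>\<^sup>2 > 4"
  shows "X\<^sup>2 * (f - \<beta>) - (g - \<beta>) = (1 - X\<^sup>2) * (M + \<beta>)"
proof -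
  have "X * (X * Y) = X"
    using X_mult_Y[OF assms] by simp
  then have "X\<^sup>2 * (k * X - a\<^sup>2 - k) - (k * Y - a\<^sup>2 - k) = (1 - X\<^sup>2) * (a\<^sup>2 + k - k * \<Phi>)"
    unfolding X_add_Y[OF assms, symmetric]
    by (simp add: algebra_simps power2_eq_square)
  moreover have "X\<^sup>2 * f - g = (X\<^sup>2 * (k * X - a\<^sup>2 - k) - (k * Y - a\<^sup>2 - k)) / a"
    unfolding fc_def gc_def by (simp only: diff_divide_distrib right_diff_distrib times_divide_eq_right)
  ultimately have "X\<^sup>2 * f - g = (1 - X\<^sup>2) * M"
    unfolding M_up_eq[OF assms(1)] by simp
  then show ?thesis
    by (simp add: algebra_simps)
qed

lemma m_low_identity:
  assumes "\<sigma> \<noteq> 0" "\<Phi>\<^sup>2 > 4"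
  shows "W\<^sup>2 * (f - \<beta>) - (g - \<beta>) = (1 - W\<^sup>2) * (m + \<beta>)"
proof -
  have "W * (W * Z) = W"
    using W_mult_Z[OF assms] by simp
  then have "W\<^sup>2 * (k * W - b\<^sup>2 - k) - (k * Z - b\<^sup>2 - k) = (1 - W\<^sup>2) * (b\<^sup>2 + k - k * \<Psi>)"
    unfolding W_add_Z[OF assms, symmetric]
    by (simp add: algebra_simps power2_eq_square)
  moreover have "W\<^sup>2 * f - g = (W\<^sup>2 * (k * W - b\<^sup>2 - k) - (k * Z - b\<^sup>2 - k)) / b"
    unfolding f_eq_2[OF assms] g_eq_2[OF assms] by (simp only: diff_divide_distrib right_diff_distrib times_divide_eq_right)
  ultimately have "W\<^sup>2 * f - g = (1 - W\<^sup>2) * m"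
    unfolding m_low_eq[OF assms(1)] by simp
  then show ?thesis
    by (simp add: algebra_simps)
qed

section \<open>Position of \<open>X\<close> and \<open>W\<close> in the ranges of sigma\<close>

lemma sign_pos:
  assumes "\<sigma> > 0" "\<Phi>\<^sup>2 > 4"
  shows "X > 1" "W > 1"
proof -
  have s: "\<sigma> \<noteq> 0" using assms by simp
  have "0 < \<Phi> * (\<sigma> * \<zeta>)"
    unfolding Phi_eq[OF s] using zeta_gt_1 by (simp add: add_pos_nonneg)
  moreover have "0 < \<sigma> * \<zeta>"
    using assms(1) zeta_gt_1 by simp
  ultimately have "0 < \<Phi>"
    by (metis zero_less_mult_iff less_asym)
  then show "X > 1"
    using larger_root_bounds(1) X_mult_Y Y_less_X X_add_Y s assms(2) by metis
  \<comment> \<open>Since \<open>\<sigma>\<^sup>2 < 1\<close>, the negative term in the numerator of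
    \<open>\<Psi>\<close> is dominated, and \<open>\<Psi>\<close> has the sign of
    \<open>\<sigma>\<close>.\<close>
  have "\<sigma>\<^sup>2 < 1"
    using assms(1) sigmac_less_1 by (simp add: power_less_one_iff)
  then have "(\<zeta> - 1) * \<sigma>\<^sup>2 \<le> \<zeta> - 1"
    using zeta_gt_1 by (simp add: mult_left_le)
  then have "0 < \<Psi> * \<sigma>"
    unfolding Psi_eq[OF s] by simp
  then have "0 < \<Psi>"
    using assms(1) by (simp add: zero_less_mult_iff)
  then show "W > 1"
    using larger_root_bounds(1) W_mult_Z Z_less_W W_add_Z s assms(2) by metis
qed

lemma Phi_neg:
  assumes "\<sigma> < 0"
  shows "\<Phi> < 0"
proof -
  have s: "\<sigma> \<noteq> 0" using assms by simp
  have "0 < \<Phi> * (\<sigma> * \<zeta>)"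
    unfolding Phi_eq[OF s] using zeta_gt_1 by (simp add: add_pos_nonneg)
  moreover have "\<sigma> * \<zeta> < 0"
    using assms zeta_gt_1 by (simp add: mult_neg_pos)
  ultimately show ?thesis
    by (metis zero_less_mult_iff less_asym)
qed

lemma sign_neg_X: "\<sigma> < 0 \<Longrightarrow> \<Phi>\<^sup>2 > 4 \<Longrightarrow> -1 < X \<and> X < 0"
  using larger_root_bounds(2) X_mult_Y Y_less_X X_add_Y Phi_neg by (metis less_irrefl)

text \<open>As \<open>\<Phi>\<close> is negative, the condition is \<open>\<Phi> + 2 < 0\<close>,
  and the numerator of \<open>\<Phi> + 2\<close> factors. It leaves two ranges of negative
  \<open>\<sigma>\<close>: above -1, and below
  \<open>-(\<zeta> + 1) / (\<zeta> - 1)\<close>.\<close>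

lemma Phi_disc_iff:
  assumes "\<sigma> < 0"
  shows "\<Phi>\<^sup>2 > 4 \<longleftrightarrow> (\<sigma> + 1) * ((\<zeta> - 1) * \<sigma> + (\<zeta> + 1)) > 0"
proof -
  have "\<Phi>\<^sup>2 > 4 \<longleftrightarrow> 2 < \<bar>\<Phi>\<bar>"
    using abs_le_square_iff[of \<Phi> 2] by (simp add: not_le[symmetric])
  also have "\<dots> \<longleftrightarrow> \<Phi> + 2 < 0"
    using Phi_neg[OF assms] by auto
  also have "\<dots> \<longleftrightarrow> (\<Phi> + 2) * (\<sigma> * \<zeta>) > 0"
    using assms zeta_gt_1 by (auto simp: zero_less_mult_iff mult_less_0_iff)
  also have "(\<Phi> + 2) * (\<sigma> * \<zeta>) = (\<sigma> + 1) * ((\<zeta> - 1) * \<sigma> + (\<zeta> + 1))"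
    using Phi_eq assms by (simp add: algebra_simps power2_eq_square)
  finally show ?thesis .
qed

lemma sign_small:
  assumes "-1 < \<sigma>" "\<sigma> < 0"
  shows "\<Phi>\<^sup>2 > 4" "-1 < X" "X < W" "W < 0"
proof -
  have s: "\<sigma> \<noteq> 0" using assms by simp
  have "0 < 2 * (1 + \<sigma>) + (\<zeta> - 1) * (\<sigma> + 1)"
    using assms zeta_gt_1 by (simp add: add_pos_pos)
  then have "0 < (\<zeta> - 1) * \<sigma> + (\<zeta> + 1)"
    using assms by (simp add: algebra_simps)
  then show d: "\<Phi>\<^sup>2 > 4"
    using assms by (simp add: Phi_disc_iff)
  then show "-1 < X"
    using sign_neg_X assms by blast
  have sq: "\<sigma>\<^sup>2 < 1"
    using assms by (simp add: abs_square_less_1)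
  then have "(\<zeta> - 1) * \<sigma>\<^sup>2 \<le> \<zeta> - 1"
    using zeta_gt_1 by (simp add: mult_left_le)
  then have "0 < \<Psi> * \<sigma>"
    unfolding Psi_eq[OF s] by simp
  then have "\<Psi> < 0"
    using assms by (simp add: zero_less_mult_iff)
  then show "W < 0"
    using larger_root_bounds(2) W_mult_Z Z_less_W W_add_Z s d by metis
  \<comment> \<open>The quadratic with roots \<open>X\<close>, \<open>Y\<close> is evaluated at
    \<open>\<sigma>\<close>. Its negative value puts \<open>\<sigma>\<close> strictly between the
    roots, and \<open>W - X\<close> equals \<open>(\<zeta> - 1) * (X - \<sigma>)\<close>.\<close>
  have "\<zeta> * ((X - \<sigma>) * (Y - \<sigma>)) = \<zeta> * (X * Y) - (X + Y) * (\<sigma> * \<zeta>) + \<zeta> * \<sigma>\<^sup>2"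
    by (simp add: algebra_simps power2_eq_square)
  also have "\<dots> = \<sigma>\<^sup>2 - 1"
    unfolding X_mult_Y[OF s d] X_add_Y[OF s d] Phi_eq[OF s] by (simp add: algebra_simps)
  finally have "\<zeta> * ((X - \<sigma>) * (Y - \<sigma>)) = \<sigma>\<^sup>2 - 1" .
  then have "\<zeta> * ((X - \<sigma>) * (Y - \<sigma>)) < 0"
    using sq by simp
  then have "(X - \<sigma>) * (Y - \<sigma>) < 0"
    using zeta_gt_1 by (simp add: mult_less_0_iff)
  then have "X > \<sigma>"
    using Y_less_X[OF s d] by (auto simp: mult_less_0_iff)
  then have "(\<zeta> - 1) * (X - \<sigma>) > 0"
    using zeta_gt_1 by simp
  then show "X < W"
    unfolding W_eq[OF s d] by (simp add: algebra_simps)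
qed

lemma sign_large:
  assumes "(\<zeta> - 1) * \<sigma> + (\<zeta> + 1) < 0"
  shows "\<sigma> < -1" "\<Phi>\<^sup>2 > 4" "-1 < X" "X < 0" "W > 1"
proof -
  have "(\<zeta> - 1) * (\<sigma> + 1) < 0"
    using assms by (simp add: algebra_simps)
  then show l: "\<sigma> < -1"
    using zeta_gt_1 by (simp add: mult_less_0_iff)
  then have s: "\<sigma> \<noteq> 0" "\<sigma> < 0" by simp_all
  show d: "\<Phi>\<^sup>2 > 4"
    using assms l s by (simp add: Phi_disc_iff mult_neg_neg)
  show "-1 < X" "X < 0"
    using sign_neg_X s d by blast+
  \<comment> \<open>The numerator of \<open>\<Psi>\<close> is split so that the hypothesis makes the
    first summand negative and \<open>\<sigma> < -1\<close> the second.\<close>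
  have "\<Psi> * \<sigma> = - (\<sigma> * ((\<zeta> - 1) * \<sigma> + (\<zeta> + 1))) + (\<zeta> + 1) * (\<sigma> + 1)"
    unfolding Psi_eq[OF s(1)] by (simp add: algebra_simps power2_eq_square)
  also have "\<dots> < 0"
    using assms s l zeta_gt_1 by (intro add_neg_neg) (auto simp: mult_neg_neg mult_pos_neg)
  finally have "\<Psi> > 0"
    using s by (simp add: mult_less_0_iff)
  then show "W > 1"
    using larger_root_bounds(1) W_mult_Z Z_less_W W_add_Z s d by metis
qed

section \<open>\<open>Bstar\<close> as the region of positive solvability\<close>

lemma small_iff: "-1 < \<sigma> \<and> \<sigma> < 0 \<longleftrightarrow> a * b \<in> {k<..<2 * k}"
  using k_pos by (auto simp: sigmac_def field_simps)

text \<open>Multiplied by \<open>k\<close>, the left expression equals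
  \<open>\<zeta> * (2 * k - a * (b - a))\<close>. This identifies the lower range of
  \<open>\<sigma>\<close> with the last condition of \<open>B2star\<close>.\<close>

lemma large_iff: "(\<zeta> - 1) * \<sigma> + (\<zeta> + 1) < 0 \<longleftrightarrow> a * (b - a) \<in> {2 * k<..}"
proof -
  have s: "k * \<sigma> = k - a * b"
    using ab_eq by (simp add: algebra_simps)
  have "k * ((\<zeta> - 1) * \<sigma> + (\<zeta> + 1)) = (\<zeta> - 1) * (k * \<sigma>) + k * (\<zeta> + 1)"
    by (simp add: algebra_simps)
  also have "\<dots> = \<zeta> * (2 * k) - \<zeta> * a * b + a * b"
    unfolding s by (simp add: algebra_simps)
  also have "\<dots> = \<zeta> * (2 * k - a * (b - a))"
    using b_eq by (simp add: algebra_simps)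
  finally have "k * ((\<zeta> - 1) * \<sigma> + (\<zeta> + 1)) = \<zeta> * (2 * k - a * (b - a))" .
  then have "k * ((\<zeta> - 1) * \<sigma> + (\<zeta> + 1)) < 0 \<longleftrightarrow> \<zeta> * (2 * k - a * (b - a)) < 0"
    by simp
  then show ?thesis
    using k_pos zeta_gt_1 by (simp add: mult_less_0_iff)
qed

text \<open>Cramer's rule for the energy equations. The right sides have been rewritten so that the
  signs of \<open>x\<close> and \<open>y\<close> depend only on the order of
  \<open>X\<^sup>2\<close>, \<open>W\<^sup>2\<close>, 1 and on the position of
  \<open>-\<beta>\<close> relative to the thresholds.\<close>

lemma energies_combine:
  assumes "\<sigma> \<noteq> 0" "\<Phi>\<^sup>2 > 4" "x + y + \<beta> = f" "x * X\<^sup>2 + y * W\<^sup>2 + \<beta> = g"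
  shows "(X\<^sup>2 - W\<^sup>2) * y = (1 - X\<^sup>2) * (M + \<beta>)" "(W\<^sup>2 - X\<^sup>2) * x = (1 - W\<^sup>2) * (m + \<beta>)"
  unfolding M_up_identity[OF assms(1,2), symmetric] m_low_identity[OF assms(1,2), symmetric]
    assms(3,4)[symmetric]
  by (simp_all add: algebra_simps)

lemma Bstar_imp:
  assumes B: "(n1, n2) \<in> Bstar lam \<beta> k"
  shows "\<sigma> < 0" "\<Phi>\<^sup>2 > 4" "X\<^sup>2 \<noteq> W\<^sup>2"
    and "\<exists>x y. x > 0 \<and> y > 0 \<and> x + y + \<beta> = f \<and> x * X\<^sup>2 + y * W\<^sup>2 + \<beta> = g"
proof -
  \<comment> \<open>The two quotients are the values that Cramer's rule gives for \<open>y\<close>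
    and \<open>x\<close>; only their positivity distinguishes the two regions.\<close>
  have *: "\<sigma> < 0 \<and> \<Phi>\<^sup>2 > 4 \<and> X\<^sup>2 \<noteq> W\<^sup>2 \<and>
      (1 - X\<^sup>2) * (M + \<beta>) / (X\<^sup>2 - W\<^sup>2) > 0 \<and> (1 - W\<^sup>2) * (m + \<beta>) / (W\<^sup>2 - X\<^sup>2) > 0"
    using B unfolding Bstar_def
  proof
    assume B1: "(n1, n2) \<in> B1star lam \<beta> k"
    then have "-1 < \<sigma> \<and> \<sigma> < 0" and c: "m < -\<beta>" "-\<beta> < M"
      using small_iff by (auto simp: B1star_def)
    then have s: "-1 < \<sigma>" "\<sigma> < 0" by auto
    note sg = sign_small[OF s]
    have "W\<^sup>2 < X\<^sup>2"
      using sg power_strict_mono[of "-W" "-X" 2] by simp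
    moreover have "X\<^sup>2 < 1"
      using sg sq_less_one by simp
    moreover have "(1 - X\<^sup>2) * (M + \<beta>) / (X\<^sup>2 - W\<^sup>2) > 0"
      using calculation c by (intro divide_pos_pos mult_pos_pos) auto
    moreover have "(1 - W\<^sup>2) * (m + \<beta>) / (W\<^sup>2 - X\<^sup>2) > 0"
      using calculation c by (intro divide_neg_neg mult_pos_neg) auto
    ultimately show ?thesis
      using s sg by auto
  next
    assume B2: "(n1, n2) \<in> B2star lam \<beta> k"
    then have "(\<zeta> - 1) * \<sigma> + (\<zeta> + 1) < 0" and c: "M < -\<beta>"
      using large_iff by (auto simp: B2star_def)
    note sg = sign_large[OF this(1)]
    then have s: "\<sigma> < 0" by simp
    have "X\<^sup>2 < 1" "W\<^sup>2 > 1"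
      using sg sq_less_one sq_greater_one by simp_all
    moreover have "m < -\<beta>"
      using m_low_less_M_up[OF s] c by simp
    moreover have "(1 - X\<^sup>2) * (M + \<beta>) / (X\<^sup>2 - W\<^sup>2) > 0"
      using calculation c by (intro divide_neg_neg mult_pos_neg) auto
    moreover have "(1 - W\<^sup>2) * (m + \<beta>) / (W\<^sup>2 - X\<^sup>2) > 0"
      using calculation c by (intro divide_pos_pos mult_neg_neg) auto
    ultimately show ?thesis
      using s sg by auto
  qed
  then show "\<sigma> < 0" "\<Phi>\<^sup>2 > 4" and ne: "X\<^sup>2 \<noteq> W\<^sup>2"
    by auto
  then have s: "\<sigma> \<noteq> 0" and d: "\<Phi>\<^sup>2 > 4" by auto
  define y x where "y = (1 - X\<^sup>2) * (M + \<beta>) / (X\<^sup>2 - W\<^sup>2)"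
    and "x = (1 - W\<^sup>2) * (m + \<beta>) / (W\<^sup>2 - X\<^sup>2)"
  have y: "(X\<^sup>2 - W\<^sup>2) * y = X\<^sup>2 * (f - \<beta>) - (g - \<beta>)"
    unfolding M_up_identity[OF s d] y_def using ne by simp
  have x: "(X\<^sup>2 - W\<^sup>2) * x = - (W\<^sup>2 * (f - \<beta>) - (g - \<beta>))"
    unfolding m_low_identity[OF s d] x_def using ne by (simp add: field_simps)
  have "(X\<^sup>2 - W\<^sup>2) * (x + y) = (X\<^sup>2 - W\<^sup>2) * (f - \<beta>)"
    using x y by (simp add: algebra_simps)
  then have e1: "x + y = f - \<beta>"
    using ne by simp
  have "(X\<^sup>2 - W\<^sup>2) * (x * X\<^sup>2 + y * W\<^sup>2)
      = X\<^sup>2 * ((X\<^sup>2 - W\<^sup>2) * x) + W\<^sup>2 * ((X\<^sup>2 - W\<^sup>2) * y)"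
    by (simp add: algebra_simps)
  also have "\<dots> = (X\<^sup>2 - W\<^sup>2) * (g - \<beta>)"
    unfolding x y by (simp add: algebra_simps)
  finally have e2: "x * X\<^sup>2 + y * W\<^sup>2 = g - \<beta>"
    using ne by simp
  have "x > 0" "y > 0"
    using * unfolding x_def y_def by auto
  with e1 e2 show "\<exists>x y. x > 0 \<and> y > 0 \<and> x + y + \<beta> = f \<and> x * X\<^sup>2 + y * W\<^sup>2 + \<beta> = g"
    by (intro exI[of _ x] exI[of _ y]) simp
qed

lemma Bstar_if:
  assumes s: "\<sigma> \<noteq> 0" and d: "\<Phi>\<^sup>2 > 4" and n: "1 \<le> n1" "n1 < n2"
    and x: "x > 0" and y: "y > 0"
    and eq: "x + y + \<beta> = f" "x * X\<^sup>2 + y * W\<^sup>2 + \<beta> = g"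
  shows "(n1, n2) \<in> Bstar lam \<beta> k"
proof -
  note c = energies_combine[OF s d eq]
  consider "\<sigma> > 0" | "-1 < \<sigma>" "\<sigma> < 0" | "\<sigma> < 0" "\<sigma> \<le> -1"
    using s by linarith
  then show ?thesis
  proof cases
    case 1
    \<comment> \<open>With both ratios beyond 1, \<open>v\<close> would carry more energy than
      \<open>u\<close>, against \<open>g < f\<close>.\<close>
    have "1 < X\<^sup>2" "1 < W\<^sup>2"
      using sign_pos[OF 1 d] sq_greater_one by auto
    then have "x * 1 \<le> x * X\<^sup>2" "y * 1 \<le> y * W\<^sup>2"
      using x y by (intro mult_left_mono; simp)+
    then have "f \<le> g"
      using eq by linarith
    then show ?thesis
      using g_less_f[OF s d] by simp
  next
    case 2
    note sg = sign_small[OF 2]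
    have W: "W\<^sup>2 < X\<^sup>2"
      using sg power_strict_mono[of "-W" "-X" 2] by simp
    have X: "X\<^sup>2 < 1"
      using sg sq_less_one by simp
    have "0 < (1 - X\<^sup>2) * (M + \<beta>)"
      unfolding c(1)[symmetric] using W y by simp
    then have "- \<beta> < M"
      using X by (simp add: zero_less_mult_iff)
    moreover have "(1 - W\<^sup>2) * (m + \<beta>) < 0"
      unfolding c(2)[symmetric] using W x by (simp add: mult_neg_pos)
    then have "m < - \<beta>"
      using X W by (simp add: mult_less_0_iff)
    ultimately have "(n1, n2) \<in> B1star lam \<beta> k"
      using 2 small_iff n by (auto simp: B1star_def)
    then show ?thesis
      by (simp add: Bstar_def)
  next
    case 3
    \<comment> \<open>For \<open>\<sigma> \<le> -1\<close> the discriminant condition excludes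
      everything except the lower range, the endpoint -1 included in what is excluded.\<close>
    have "(\<sigma> + 1) * ((\<zeta> - 1) * \<sigma> + (\<zeta> + 1)) > 0"
      using Phi_disc_iff[OF 3(1)] d by simp
    then have neg: "(\<zeta> - 1) * \<sigma> + (\<zeta> + 1) < 0"
      using 3 by (auto simp: zero_less_mult_iff)
    note sg = sign_large[OF neg]
    have X: "X\<^sup>2 < 1" and W: "W\<^sup>2 > 1"
      using sg sq_less_one sq_greater_one by simp_all
    have "(1 - X\<^sup>2) * (M + \<beta>) < 0"
      unfolding c(1)[symmetric] using X W y by (simp add: mult_neg_pos)
    then have "M < - \<beta>"
      using X by (simp add: mult_less_0_iff)
    then have "(n1, n2) \<in> B2star lam \<beta> k"
      using neg large_iff n by (auto simp: B2star_def)
    then show ?thesis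
      by (simp add: Bstar_def)
  qed
qed

section \<open>From the mode equations to the ratios and back\<close>

lemma mode_ratios:
  assumes nz: "\<alpha>1 \<noteq> 0" "\<alpha>2 \<noteq> 0" "\<gamma>1 \<noteq> 0" "\<gamma>2 \<noteq> 0" and less: "E < C"
    and eqs: "a\<^sup>2 * \<alpha>1 + C * a * \<alpha>1 + k * (\<alpha>1 - \<gamma>1) = 0"
      "b\<^sup>2 * \<alpha>2 + C * b * \<alpha>2 + k * (\<alpha>2 - \<gamma>2) = 0"
      "a\<^sup>2 * \<gamma>1 + E * a * \<gamma>1 - k * (\<alpha>1 - \<gamma>1) = 0"
      "b\<^sup>2 * \<gamma>2 + E * b * \<gamma>2 - k * (\<alpha>2 - \<gamma>2) = 0"
  shows "\<sigma> \<noteq> 0" "\<Phi>\<^sup>2 > 4" "\<gamma>1 = \<alpha>1 * X" "\<gamma>2 = \<alpha>2 * W" "C = f" "E = g"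
proof -
  define p q where "p = \<gamma>1 / \<alpha>1" and "q = \<gamma>2 / \<alpha>2"
  have p: "k * p = a\<^sup>2 + C * a + k" and q: "k * q = b\<^sup>2 + C * b + k"
    and p': "k * (1 / p) = a\<^sup>2 + E * a + k" and q': "k * (1 / q) = b\<^sup>2 + E * b + k"
    using eqs nz by (simp_all add: p_def q_def field_simps)
  have kab: "k * ((b - a) * \<sigma>) = (b - a) * (k - a * b)"
    unfolding ab_eq by (simp add: algebra_simps)
  \<comment> \<open>This combination of the two modes cancels the unknown \<open>C\<close>; the
    analogous one with reciprocals cancels \<open>E\<close>.\<close>
  have "k * (b * p - a * q) = b * (k * p) - a * (k * q)"
    by (simp add: algebra_simps)
  also have "\<dots> = k * ((b - a) * \<sigma>)"
    unfolding p q kab by (simp add: algebra_simps power2_eq_square)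
  finally have 1: "b * p - a * q = (b - a) * \<sigma>"
    using k_pos by simp
  have "k * (b / p - a / q) = b * (k * (1 / p)) - a * (k * (1 / q))"
    by (simp add: algebra_simps)
  also have "\<dots> = k * ((b - a) * \<sigma>)"
    unfolding p' q' kab by (simp add: algebra_simps power2_eq_square)
  finally have 2: "b / p - a / q = (b - a) * \<sigma>"
    using k_pos by simp
  have "E * a < C * a"
    using less lam_pos by simp
  then have "k * (1 / p) < k * p"
    unfolding p p' by simp
  then have 3: "1 / p < p"
    using k_pos mult_less_cancel_left_pos by blast
  have "p \<noteq> 0" "q \<noteq> 0"
    using nz by (simp_all add: p_def q_def)
  note u = ratios_unique[OF this 1 2 3]
  show "\<sigma> \<noteq> 0" "\<Phi>\<^sup>2 > 4" by (fact u)+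
  show "\<gamma>1 = \<alpha>1 * X" "\<gamma>2 = \<alpha>2 * W"
    unfolding u(3)[symmetric] u(5)[symmetric] p_def q_def using nz by simp_all
  show "C = f" "E = g"
    unfolding fc_def gc_def u(3)[symmetric] u(4)[symmetric] p p' using lam_pos by simp_all
qed

lemma mode_equations:
  assumes "\<sigma> \<noteq> 0" "\<Phi>\<^sup>2 > 4"
  shows "a\<^sup>2 * r + f * a * r + k * (r - r * X) = 0" "b\<^sup>2 * t + f * b * t + k * (t - t * W) = 0"
    "a\<^sup>2 * (r * X) + g * a * (r * X) - k * (r - r * X) = 0"
    "b\<^sup>2 * (t * W) + g * b * (t * W) - k * (t - t * W) = 0"
proof -
  have f: "f * a = k * X - a\<^sup>2 - k" "f * b = k * W - b\<^sup>2 - k"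
    using lam_pos b_pos by (simp add: fc_def, subst f_eq_2[OF assms], simp)
  have g: "g * a = k * Y - a\<^sup>2 - k" "g * b = k * Z - b\<^sup>2 - k"
    using lam_pos b_pos by (simp add: gc_def, subst g_eq_2[OF assms], simp)
  show "a\<^sup>2 * r + f * a * r + k * (r - r * X) = 0" "b\<^sup>2 * t + f * b * t + k * (t - t * W) = 0"
    unfolding f by (simp_all add: algebra_simps)
  \<comment> \<open>The equations for \<open>v\<close> reduce to the reciprocity of the roots, those
    for \<open>u\<close> having held by the choice of \<open>f\<close> alone.\<close>
  have "a\<^sup>2 * (r * X) + g * a * (r * X) - k * (r - r * X) = k * r * (X * Y - 1)"
    "b\<^sup>2 * (t * W) + g * b * (t * W) - k * (t - t * W) = k * t * (W * Z - 1)"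
    unfolding g by (simp_all add: algebra_simps)
  then show "a\<^sup>2 * (r * X) + g * a * (r * X) - k * (r - r * X) = 0"
    "b\<^sup>2 * (t * W) + g * b * (t * W) - k * (t - t * W) = 0"
    using X_mult_Y[OF assms] W_mult_Z[OF assms] by simp_all
qed

end

section \<open>Reduction to two modes\<close>

text \<open>The conditions are linear in the squares of \<open>r\<close> and \<open>t\<close>, with
  determinant nonzero because \<open>p\<^sup>2 \<noteq> q\<^sup>2\<close>. So both squares are
  determined, and a given positive solution leaves exactly the four choices of signs.\<close>

lemma card_solution_family:
  fixes e :: "nat \<Rightarrow> 'a::real_inner"
  assumes on: "inner (e n1) (e n1) = 1" "inner (e n2) (e n2) = 1" "inner (e n1) (e n2) = 0"
    and pos: "\<rho> > 0" "lam n1 > 0" "lam n2 > 0" and pq: "p\<^sup>2 \<noteq> q\<^sup>2"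
    and x: "x > 0" and y: "y > 0" and eq: "x + y + \<beta> = c" "x * p\<^sup>2 + y * q\<^sup>2 + \<beta> = d"
  shows "card (solution_family lam e \<beta> \<rho> n1 n2 p q c d) = 4"
    and "(u, v) \<in> solution_family lam e \<beta> \<rho> n1 n2 p q c d \<Longrightarrow>
      \<exists>r t. r \<noteq> 0 \<and> t \<noteq> 0 \<and> u = r *\<^sub>R e n1 + t *\<^sub>R e n2 \<and> v = (r * p) *\<^sub>R e n1 + (t * q) *\<^sub>R e n2 \<and>
        \<rho> * r\<^sup>2 * lam n1 + \<rho> * t\<^sup>2 * lam n2 + \<beta> = c \<and>
        \<rho> * r\<^sup>2 * lam n1 * p\<^sup>2 + \<rho> * t\<^sup>2 * lam n2 * q\<^sup>2 + \<beta> = d"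
proof -
  define R T where "R = sqrt (x / (\<rho> * lam n1))" and "T = sqrt (y / (\<rho> * lam n2))"
  have RT: "R > 0" "T > 0"
    using x y pos by (simp_all add: R_def T_def)
  have R2: "\<rho> * R\<^sup>2 * lam n1 = x" and T2: "\<rho> * T\<^sup>2 * lam n2 = y"
    using x y pos by (simp_all add: R_def T_def)
  have iff: "\<rho> * r\<^sup>2 * lam n1 + \<rho> * t\<^sup>2 * lam n2 + \<beta> = c \<and>
        \<rho> * r\<^sup>2 * lam n1 * p\<^sup>2 + \<rho> * t\<^sup>2 * lam n2 * q\<^sup>2 + \<beta> = d \<longleftrightarrow> r \<in> {R, -R} \<and> t \<in> {T, -T}"
    (is "?E \<longleftrightarrow> ?S") for r t
  proof
    assume E: ?E
    define x' y' where "x' = \<rho> * r\<^sup>2 * lam n1" and "y' = \<rho> * t\<^sup>2 * lam n2"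
    have s1: "x' - x = - (y' - y)" and s2: "(x' - x) * p\<^sup>2 + (y' - y) * q\<^sup>2 = 0"
      using E eq by (simp_all add: x'_def y'_def algebra_simps)
    have "(y' - y) * (q\<^sup>2 - p\<^sup>2) = 0"
      using s2 unfolding s1 by (simp add: algebra_simps)
    then have "y' = y" and "x' = x"
      using pq s1 by auto
    then have "\<rho> * r\<^sup>2 * lam n1 = \<rho> * R\<^sup>2 * lam n1" "\<rho> * t\<^sup>2 * lam n2 = \<rho> * T\<^sup>2 * lam n2"
      unfolding R2 T2 by (simp_all add: x'_def y'_def)
    then have "r\<^sup>2 = R\<^sup>2" "t\<^sup>2 = T\<^sup>2"
      using pos by simp_all
    then show ?S
      by (simp add: power2_eq_iff)
  next
    assume ?S
    then have "r\<^sup>2 = R\<^sup>2" "t\<^sup>2 = T\<^sup>2" by auto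
    then show ?E
      using R2 T2 eq by simp
  qed
  define F where "F = (\<lambda>(r, t). (r *\<^sub>R e n1 + t *\<^sub>R e n2, (r * p) *\<^sub>R e n1 + (t * q) *\<^sub>R e n2))"
  have fam: "solution_family lam e \<beta> \<rho> n1 n2 p q c d = F ` ({R, -R} \<times> {T, -T})"
  proof -
    have "{(u, v). \<exists>r t. u = U r t \<and> v = V r t \<and> r \<in> P \<and> t \<in> Q} = (\<lambda>(r, t). (U r t, V r t)) ` (P \<times> Q)"
      for U V :: "real \<Rightarrow> real \<Rightarrow> 'a" and P Q
      by auto
    then show ?thesis
      unfolding solution_family_def iff F_def .
  qed
  have coord: "inner (r *\<^sub>R e n1 + t *\<^sub>R e n2) (e n1) = r" "inner (r *\<^sub>R e n1 + t *\<^sub>R e n2) (e n2) = t"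
    for r t
    using on on(3)[unfolded inner_commute[of "e n1" "e n2"]] by (simp_all add: inner_add_left)
  \<comment> \<open>The coefficients \<open>r\<close> and \<open>t\<close> are recovered from the
    first component by orthonormality.\<close>
  have "inj F"
    unfolding F_def by (rule injI) (auto, metis coord(1), metis coord(2))
  then have "card (solution_family lam e \<beta> \<rho> n1 n2 p q c d) = card ({R, -R} \<times> {T, -T})"
    unfolding fam by (metis card_image inj_on_subset subset_UNIV)
  also have "\<dots> = 4"
    using RT by (simp add: card_cartesian_product)
  finally show "card (solution_family lam e \<beta> \<rho> n1 n2 p q c d) = 4" .
  assume "(u, v) \<in> solution_family lam e \<beta> \<rho> n1 n2 p q c d"
  then obtain r t where rt: "u = r *\<^sub>R e n1 + t *\<^sub>R e n2" "v = (r * p) *\<^sub>R e n1 + (t * q) *\<^sub>R e n2"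
        "\<rho> * r\<^sup>2 * lam n1 + \<rho> * t\<^sup>2 * lam n2 + \<beta> = c"
        "\<rho> * r\<^sup>2 * lam n1 * p\<^sup>2 + \<rho> * t\<^sup>2 * lam n2 * q\<^sup>2 + \<beta> = d"
    unfolding solution_family_def by blast
  moreover have "r \<noteq> 0" "t \<noteq> 0"
    using iff[of r t] rt(3,4) RT by auto
  ultimately show "\<exists>r t. r \<noteq> 0 \<and> t \<noteq> 0 \<and> u = r *\<^sub>R e n1 + t *\<^sub>R e n2 \<and>
        v = (r * p) *\<^sub>R e n1 + (t * q) *\<^sub>R e n2 \<and>
        \<rho> * r\<^sup>2 * lam n1 + \<rho> * t\<^sup>2 * lam n2 + \<beta> = c \<and>
        \<rho> * r\<^sup>2 * lam n1 * p\<^sup>2 + \<rho> * t\<^sup>2 * lam n2 * q\<^sup>2 + \<beta> = d"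
    by blast
qed

text \<open>Exchanging \<open>u\<close> and \<open>v\<close> amounts to the new parameters
  \<open>r * p\<close> and \<open>t * q\<close>, for which the ratios become the
  reciprocals.\<close>

lemma solution_family_swap:
  assumes "p * p' = 1" "q * q' = 1"
  shows "solution_family lam e \<beta> \<rho> n1 n2 p' q' d c
    = prod.swap ` solution_family lam e \<beta> \<rho> n1 n2 p q c d"
proof -
  have sub: "(v, u) \<in> solution_family lam e \<beta> \<rho> n1 n2 p' q' d c"
    if fam: "(u, v) \<in> solution_family lam e \<beta> \<rho> n1 n2 p q c d" and pq: "p * p' = 1" "q * q' = 1"
    for u v p p' q q' c d
  proof -
    obtain r t where *: "u = r *\<^sub>R e n1 + t *\<^sub>R e n2" "v = (r * p) *\<^sub>R e n1 + (t * q) *\<^sub>R e n2"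
        "\<rho> * r\<^sup>2 * lam n1 + \<rho> * t\<^sup>2 * lam n2 + \<beta> = c"
        "\<rho> * r\<^sup>2 * lam n1 * p\<^sup>2 + \<rho> * t\<^sup>2 * lam n2 * q\<^sup>2 + \<beta> = d"
      using fam unfolding solution_family_def by blast
    have r: "r * p * p' = r" "t * q * q' = t"
      using pq by (simp_all add: mult.assoc)
    have "\<rho> * (r * p)\<^sup>2 * lam n1 * p'\<^sup>2 + \<rho> * (t * q)\<^sup>2 * lam n2 * q'\<^sup>2 + \<beta>
        = \<rho> * (r * p * p')\<^sup>2 * lam n1 + \<rho> * (t * q * q')\<^sup>2 * lam n2 + \<beta>"
      by (simp add: power_mult_distrib mult_ac)
    then have "\<rho> * (r * p)\<^sup>2 * lam n1 * p'\<^sup>2 + \<rho> * (t * q)\<^sup>2 * lam n2 * q'\<^sup>2 + \<beta> = c"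
      unfolding r *(3) .
    moreover have "\<rho> * (r * p)\<^sup>2 * lam n1 + \<rho> * (t * q)\<^sup>2 * lam n2 + \<beta> = d"
      using *(4) by (simp add: power_mult_distrib mult_ac)
    moreover have "u = (r * p * p') *\<^sub>R e n1 + (t * q * q') *\<^sub>R e n2"
      unfolding r *(1) ..
    ultimately show ?thesis
      unfolding solution_family_def using *(2) by blast
  qed
  have "w \<in> prod.swap ` solution_family lam e \<beta> \<rho> n1 n2 p q c d"
    if "w \<in> solution_family lam e \<beta> \<rho> n1 n2 p' q' d c" for w
    using sub[of "fst w" "snd w" p' q' d c p q] that assms
    by (intro image_eqI[of _ _ "(snd w, fst w)"]) (simp_all add: mult.commute)
  then show ?thesis
    using sub[OF _ assms] by auto
qed

section \<open>Spectral calculus on vectors with two modes\<close>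

locale spectral =
  fixes D :: "'a::{real_inner,complete_space} set" and A lam e
  assumes sa: "selfadjoint_op D A" and sd: "simple_spectral_data D A lam e"
begin

lemma orthonormal: "m \<ge> 1 \<Longrightarrow> n \<ge> 1 \<Longrightarrow> inner (e m) (e n) = (if m = n then 1 else 0)"
  using sd by (simp add: simple_spectral_data_def)

lemma lam_positive: "n \<ge> 1 \<Longrightarrow> 0 < lam n"
  using sd by (simp add: simple_spectral_data_def)

lemma lam_mono: "1 \<le> m \<Longrightarrow> m < n \<Longrightarrow> lam m < lam n"
  using sd by (auto simp: simple_spectral_data_def strict_mono_on_def)

lemma op_pow_two_modes:
  assumes n: "n1 \<ge> 1" "n2 \<ge> 1" "n1 \<noteq> n2"
  shows "\<alpha> *\<^sub>R e n1 + \<gamma> *\<^sub>R e n2 \<in> dom_pow lam e s"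
    and "op_pow lam e s (\<alpha> *\<^sub>R e n1 + \<gamma> *\<^sub>R e n2)
      = (\<alpha> * lam n1 powr s) *\<^sub>R e n1 + (\<gamma> * lam n2 powr s) *\<^sub>R e n2"
proof -
  let ?u = "\<alpha> *\<^sub>R e n1 + \<gamma> *\<^sub>R e n2"
  have i: "inner ?u (e m) = (if m = n1 then \<alpha> else if m = n2 then \<gamma> else 0)" if "m \<ge> 1" for m
    using n that orthonormal by (auto simp: inner_add_left)
  have "((\<lambda>m. (lam m powr s * inner ?u (e m))\<^sup>2) has_sum
      (\<Sum>m\<in>{n1,n2}. (lam m powr s * inner ?u (e m))\<^sup>2)) {1..}"
    by (rule has_sum_finite_neutralI[of "{n1,n2}"]) (use n i in auto)
  then show "?u \<in> dom_pow lam e s"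
    unfolding dom_pow_def mem_Collect_eq by (rule has_sum_imp_summable)
  have "((\<lambda>m. (lam m powr s * inner ?u (e m)) *\<^sub>R e m) has_sum
      (\<Sum>m\<in>{n1,n2}. (lam m powr s * inner ?u (e m)) *\<^sub>R e m)) {1..}"
    by (rule has_sum_finite_neutralI[of "{n1,n2}"]) (use n i in auto)
  then show "op_pow lam e s ?u = (\<alpha> * lam n1 powr s) *\<^sub>R e n1 + (\<gamma> * lam n2 powr s) *\<^sub>R e n2"
    unfolding op_pow_def using n by (auto dest!: infsumI simp: i mult.commute)
qed

text \<open>The weights satisfy \<open>lam n \<le> (lam n)\<^sup>2 + 1\<close>, and Bessel's
  inequality sums the part with weight 1. Test functions in \<open>H^2\<close> may thus be paired in
  \<open>H^1\<close>.\<close>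

lemma Hsp_mono: "Hsp lam e 2 \<subseteq> Hsp lam e 1"
proof
  fix x assume x: "x \<in> Hsp lam e 2"
  have on: "\<forall>m\<ge>1. \<forall>n\<ge>1. inner (e m) (e n) = (if m = n then 1 else 0)"
    using orthonormal by blast
  have "(\<lambda>n. (lam n powr 1 * inner x (e n))\<^sup>2 + (inner x (e n))\<^sup>2) summable_on {1..}"
    using x orthonormal_bessel[OF on, of x]
    by (intro summable_on_add) (simp_all add: Hsp_def dom_pow_def)
  then have "(\<lambda>n. (lam n powr (1/2) * inner x (e n))\<^sup>2) summable_on {1..}"
  proof (rule summable_on_comparison_test)
    fix n :: nat assume "n \<in> {1..}"
    then have l: "lam n > 0" using lam_positive by simp
    have sq: "(lam n powr (1/2))\<^sup>2 = lam n"
      using l by (simp add: powr_half_sqrt)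
    have "0 \<le> (lam n - 1)\<^sup>2 + lam n" using l by simp
    then have "lam n \<le> (lam n)\<^sup>2 + 1" by (simp add: power2_eq_square algebra_simps)
    then have "lam n * (inner x (e n))\<^sup>2 \<le> ((lam n)\<^sup>2 + 1) * (inner x (e n))\<^sup>2"
      by (intro mult_right_mono) auto
    then show "(lam n powr (1/2) * inner x (e n))\<^sup>2 \<le> (lam n powr 1 * inner x (e n))\<^sup>2 + (inner x (e n))\<^sup>2"
      unfolding power_mult_distrib sq using l by (simp add: algebra_simps)
  qed auto
  then show "x \<in> Hsp lam e 1"
    by (simp add: Hsp_def dom_pow_def)
qed

text \<open>Membership of \<open>\<phi>\<close> in \<open>H^r\<close> matters: outside it the sum
  defining \<open>op_pow\<close> diverges and takes the default value 0.\<close>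

lemma Hinner_two_modes:
  assumes n: "n1 \<ge> 1" "n2 \<ge> 1" "n1 \<noteq> n2" and \<phi>: "\<phi> \<in> Hsp lam e r"
  shows "Hinner lam e r (\<alpha> *\<^sub>R e n1 + \<gamma> *\<^sub>R e n2) \<phi>
    = \<alpha> * lam n1 powr r * inner \<phi> (e n1) + \<gamma> * lam n2 powr r * inner \<phi> (e n2)"
proof -
  have p: "lam m powr (r/2) * lam m powr (r/2) = lam m powr r" for m
    by (simp add: powr_add[symmetric])
  have i: "inner (e m) (op_pow lam e (r/2) \<phi>) = lam m powr (r/2) * inner \<phi> (e m)" if "m \<ge> 1" for m
    using inner_op_pow[OF sa sd _ that] \<phi> by (simp add: Hsp_def inner_commute)
  show ?thesis
    unfolding Hinner_def op_pow_two_modes(2)[OF n] inner_add_left inner_scaleR_left i[OF n(1)] i[OF n(2)]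
    by (simp add: p[symmetric] mult_ac)
qed

lemma Hnorm_two_modes:
  assumes n: "n1 \<ge> 1" "n2 \<ge> 1" "n1 \<noteq> n2"
  shows "(Hnorm lam e 1 (\<alpha> *\<^sub>R e n1 + \<gamma> *\<^sub>R e n2))\<^sup>2 = \<alpha>\<^sup>2 * lam n1 + \<gamma>\<^sup>2 * lam n2"
proof -
  have "(Hnorm lam e 1 (\<alpha> *\<^sub>R e n1 + \<gamma> *\<^sub>R e n2))\<^sup>2
      = Hinner lam e 1 (\<alpha> *\<^sub>R e n1 + \<gamma> *\<^sub>R e n2) (\<alpha> *\<^sub>R e n1 + \<gamma> *\<^sub>R e n2)"
    by (simp add: Hnorm_def Hinner_def power2_norm_eq_inner)
  also have "\<dots> = \<alpha>\<^sup>2 * lam n1 + \<gamma>\<^sup>2 * lam n2"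
    using op_pow_two_modes(1)[OF n] n orthonormal lam_positive[OF n(1)] lam_positive[OF n(2)]
    by (subst Hinner_two_modes[OF n]) (auto simp: Hsp_def inner_add_left power2_eq_square)
  finally show ?thesis .
qed

text \<open>On such couples each weak equation sees only two coordinates of the test function, and
  testing with \<open>e n1\<close> and \<open>e n2\<close> separates the modes.\<close>

lemma weak_solution_two_modes:
  fixes \<alpha>1 \<alpha>2 \<gamma>1 \<gamma>2 \<beta> \<rho> k :: real
  assumes n: "n1 \<ge> 1" "n2 \<ge> 1" "n1 \<noteq> n2"
  defines "u \<equiv> \<alpha>1 *\<^sub>R e n1 + \<alpha>2 *\<^sub>R e n2" and "v \<equiv> \<gamma>1 *\<^sub>R e n1 + \<gamma>2 *\<^sub>R e n2"
  defines "C \<equiv> \<beta> + \<rho> * (\<alpha>1\<^sup>2 * lam n1 + \<alpha>2\<^sup>2 * lam n2)"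
    and "E \<equiv> \<beta> + \<rho> * (\<gamma>1\<^sup>2 * lam n1 + \<gamma>2\<^sup>2 * lam n2)"
  shows "weak_solution lam e \<beta> \<rho> k u v \<longleftrightarrow>
    (lam n1)\<^sup>2 * \<alpha>1 + C * lam n1 * \<alpha>1 + k * (\<alpha>1 - \<gamma>1) = 0 \<and>
    (lam n2)\<^sup>2 * \<alpha>2 + C * lam n2 * \<alpha>2 + k * (\<alpha>2 - \<gamma>2) = 0 \<and>
    (lam n1)\<^sup>2 * \<gamma>1 + E * lam n1 * \<gamma>1 - k * (\<alpha>1 - \<gamma>1) = 0 \<and>
    (lam n2)\<^sup>2 * \<gamma>2 + E * lam n2 * \<gamma>2 - k * (\<alpha>2 - \<gamma>2) = 0"
    (is "_ \<longleftrightarrow> ?a1 = 0 \<and> ?a2 = 0 \<and> ?c1 = 0 \<and> ?c2 = 0")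
proof -
  have l: "lam n1 > 0" "lam n2 > 0"
    using n lam_positive by auto
  have eqs: "Hinner lam e 2 u \<phi> + C * Hinner lam e 1 u \<phi> + k * inner (u - v) \<phi>
        = ?a1 * inner \<phi> (e n1) + ?a2 * inner \<phi> (e n2)"
      "Hinner lam e 2 v \<phi> + E * Hinner lam e 1 v \<phi> - k * inner (u - v) \<phi>
        = ?c1 * inner \<phi> (e n1) + ?c2 * inner \<phi> (e n2)"
    if \<phi>: "\<phi> \<in> Hsp lam e 2" for \<phi>
  proof -
    have \<phi>1: "\<phi> \<in> Hsp lam e 1" using \<phi> Hsp_mono by blast
    have uv: "inner (u - v) \<phi> = (\<alpha>1 - \<gamma>1) * inner \<phi> (e n1) + (\<alpha>2 - \<gamma>2) * inner \<phi> (e n2)"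
      by (simp add: u_def v_def inner_commute inner_add_right inner_diff_right algebra_simps)
    show "Hinner lam e 2 u \<phi> + C * Hinner lam e 1 u \<phi> + k * inner (u - v) \<phi>
        = ?a1 * inner \<phi> (e n1) + ?a2 * inner \<phi> (e n2)"
      "Hinner lam e 2 v \<phi> + E * Hinner lam e 1 v \<phi> - k * inner (u - v) \<phi>
        = ?c1 * inner \<phi> (e n1) + ?c2 * inner \<phi> (e n2)"
      unfolding uv unfolding u_def v_def Hinner_two_modes[OF n \<phi>] Hinner_two_modes[OF n \<phi>1]
      using l by (simp_all add: algebra_simps)
  qed
  have mem: "x *\<^sub>R e n1 + y *\<^sub>R e n2 \<in> Hsp lam e 2" for x y
    using op_pow_two_modes(1)[OF n] by (simp add: Hsp_def)
  have e1: "e n1 \<in> Hsp lam e 2" and e2: "e n2 \<in> Hsp lam e 2"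
    using mem[of 1 0] mem[of 0 1] by simp_all
  have "weak_solution lam e \<beta> \<rho> k u v \<longleftrightarrow>
    (\<forall>\<phi>\<in>Hsp lam e 2. \<forall>\<psi>\<in>Hsp lam e 2.
      ?a1 * inner \<phi> (e n1) + ?a2 * inner \<phi> (e n2) = 0 \<and>
      ?c1 * inner \<psi> (e n1) + ?c2 * inner \<psi> (e n2) = 0)" (is "_ \<longleftrightarrow> ?R")
  proof -
    have "\<beta> + \<rho> * (Hnorm lam e 1 u)\<^sup>2 = C" "\<beta> + \<rho> * (Hnorm lam e 1 v)\<^sup>2 = E"
      by (simp_all add: C_def E_def u_def v_def Hnorm_two_modes[OF n])
    moreover have "u \<in> Hsp lam e 2" "v \<in> Hsp lam e 2"
      unfolding u_def v_def by (rule mem)+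
    ultimately show ?thesis
      unfolding weak_solution_def Let_def by (simp add: eqs cong: ball_cong)
  qed
  also have "?R \<longleftrightarrow> ?a1 = 0 \<and> ?a2 = 0 \<and> ?c1 = 0 \<and> ?c2 = 0"
  proof
    assume R: ?R
    show "?a1 = 0 \<and> ?a2 = 0 \<and> ?c1 = 0 \<and> ?c2 = 0"
      using R[rule_format, OF e1 e1] R[rule_format, OF e2 e2] n orthonormal by simp
  qed simp
  finally show ?thesis .
qed


section \<open>Symmetries of the solution sets and uniqueness of the modes\<close>

lemma mode_pair: "1 \<le> n1 \<Longrightarrow> n1 < n2 \<Longrightarrow> k > 0 \<Longrightarrow> mode_pair lam n1 n2 k"
  by unfold_locales (use lam_positive lam_mono in auto)

text \<open>The modes are the indices at which \<open>u\<close> has a nonzero coordinate; the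
  ordering then fixes the pair.\<close>

lemma solution_modes_unique:
  assumes "1 \<le> n1" "n1 < n2" "1 \<le> m1" "m1 < m2"
    and uv: "(u, v) \<in> bimodal_NE_solutions lam e \<beta> \<rho> k n1 n2" "(u, v) \<in> bimodal_NE_solutions lam e \<beta> \<rho> k m1 m2"
  shows "n1 = m1" "n2 = m2"
proof -
  have modes: "{n. n \<ge> 1 \<and> inner u (e n) \<noteq> 0} = {i, j}"
    if "1 \<le> i" "i < j" and S: "(u, v) \<in> bimodal_NE_solutions lam e \<beta> \<rho> k i j" for i j
  proof -
    obtain \<alpha>1 \<alpha>2 where "\<alpha>1 \<noteq> 0" "\<alpha>2 \<noteq> 0" "u = \<alpha>1 *\<^sub>R e i + \<alpha>2 *\<^sub>R e j"
      using S unfolding bimodal_NE_solutions_def bimodal_def by blast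
    then show ?thesis
      using that(1,2) orthonormal by (auto simp: inner_add_left split: if_splits)
  qed
  have "{n1, n2} = {m1, m2}"
    using modes[OF assms(1,2) uv(1)] modes[OF assms(3,4) uv(2)] by simp
  then show "n1 = m1" "n2 = m2"
    using assms(2,4) by (auto simp: doubleton_eq_iff)
qed

lemma bimodal_NE_solutions_swap:
  "(u, v) \<in> bimodal_NE_solutions lam e \<beta> \<rho> k n1 n2 \<Longrightarrow> (v, u) \<in> bimodal_NE_solutions lam e \<beta> \<rho> k n1 n2"
proof -
  assume S: "(u, v) \<in> bimodal_NE_solutions lam e \<beta> \<rho> k n1 n2"
  have "inner (v - u) x = - inner (u - v) x" for x
    by (simp add: inner_diff_left)
  then have "weak_solution lam e \<beta> \<rho> k v u"
    using S unfolding bimodal_NE_solutions_def weak_solution_def Let_def by auto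
  moreover have "bimodal e n1 n2 v u"
    using S unfolding bimodal_NE_solutions_def bimodal_def by blast
  ultimately show ?thesis
    using S by (auto simp: bimodal_NE_solutions_def)
qed

text \<open>The set of all solutions is a union over pairs in either order; this folds it onto pairs
  with \<open>n1 < n2\<close>.\<close>

lemma bimodal_NE_solutions_commute:
  "bimodal_NE_solutions lam e \<beta> \<rho> k n1 n2 = bimodal_NE_solutions lam e \<beta> \<rho> k n2 n1"
proof -
  have "bimodal e n2 n1 u v" if "bimodal e n1 n2 u v" for n1 n2 u v
    using that unfolding bimodal_def by (metis add.commute)
  then show ?thesis
    unfolding bimodal_NE_solutions_def by blast
qed

end

section \<open>Counting the solutions\<close>

locale mode_pair_solutions = spectral D A lam e + mode_pair lam n1 n2 k
  for D :: "'a::{real_inner,complete_space} set" and A lam e n1 n2 k +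
  fixes \<beta> \<rho> :: real
  assumes n: "1 \<le> n1" "n1 < n2" and rho_pos: "\<rho> > 0"
begin

abbreviation "S \<equiv> bimodal_NE_solutions lam e \<beta> \<rho> k n1 n2"
abbreviation "S1 \<equiv> solution_family lam e \<beta> \<rho> n1 n2 X W f g"
abbreviation "S2 \<equiv> solution_family lam e \<beta> \<rho> n1 n2 Y Z g f"

lemma n': "n1 \<ge> 1" "n2 \<ge> 1" "n1 \<noteq> n2"
  using n by auto

text \<open>The solutions in which \<open>u\<close> has the larger energy suffice; the others follow
  by exchanging \<open>u\<close> and \<open>v\<close>.\<close>

lemma solution_in_family:
  assumes uv: "(u, v) \<in> S" and less: "Hnorm lam e 1 v < Hnorm lam e 1 u"
  shows "(n1, n2) \<in> Bstar lam \<beta> k" "(u, v) \<in> S1"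
proof -
  obtain \<alpha>1 \<alpha>2 \<gamma>1 \<gamma>2 where nz: "\<alpha>1 \<noteq> 0" "\<alpha>2 \<noteq> 0" "\<gamma>1 \<noteq> 0" "\<gamma>2 \<noteq> 0"
    and u: "u = \<alpha>1 *\<^sub>R e n1 + \<alpha>2 *\<^sub>R e n2" and v: "v = \<gamma>1 *\<^sub>R e n1 + \<gamma>2 *\<^sub>R e n2"
    and ws: "weak_solution lam e \<beta> \<rho> k u v"
    using uv unfolding bimodal_NE_solutions_def bimodal_def by blast
  define C E where "C = \<beta> + \<rho> * (\<alpha>1\<^sup>2 * a + \<alpha>2\<^sup>2 * b)" and "E = \<beta> + \<rho> * (\<gamma>1\<^sup>2 * a + \<gamma>2\<^sup>2 * b)"
  have "(Hnorm lam e 1 v)\<^sup>2 < (Hnorm lam e 1 u)\<^sup>2"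
    using less by (rule power_strict_mono) (simp_all add: Hnorm_def)
  then have "E < C"
    using rho_pos unfolding u v Hnorm_two_modes[OF n'] C_def E_def by simp
  have "\<sigma> \<noteq> 0 \<and> \<Phi>\<^sup>2 > 4 \<and> \<gamma>1 = \<alpha>1 * X \<and> \<gamma>2 = \<alpha>2 * W \<and> C = f \<and> E = g"
    using ws[unfolded u v weak_solution_two_modes[OF n'], folded C_def E_def]
      mode_ratios[OF nz \<open>E < C\<close>] by blast
  then have s: "\<sigma> \<noteq> 0" "\<Phi>\<^sup>2 > 4" and \<gamma>: "\<gamma>1 = \<alpha>1 * X" "\<gamma>2 = \<alpha>2 * W" and CE: "C = f" "E = g"
    by auto
  have eq: "\<rho> * \<alpha>1\<^sup>2 * a + \<rho> * \<alpha>2\<^sup>2 * b + \<beta> = f"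
    "\<rho> * \<alpha>1\<^sup>2 * a * X\<^sup>2 + \<rho> * \<alpha>2\<^sup>2 * b * W\<^sup>2 + \<beta> = g"
    unfolding CE[symmetric] C_def E_def \<gamma> by (simp_all add: power_mult_distrib algebra_simps)
  show "(u, v) \<in> S1"
    unfolding solution_family_def u v \<gamma> using eq by blast
  show "(n1, n2) \<in> Bstar lam \<beta> k"
    by (rule Bstar_if[OF s n _ _ eq]) (use rho_pos lam_pos b_pos nz in auto)
qed

lemma solutions_outside:
  assumes "(n1, n2) \<notin> Bstar lam \<beta> k"
  shows "S = {}"
proof (rule ccontr)
  assume "S \<noteq> {}"
  then obtain u v where uv: "(u, v) \<in> S" by auto
  then have "Hnorm lam e 1 u \<noteq> Hnorm lam e 1 v"
    by (simp add: bimodal_NE_solutions_def)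
  then show False
    using solution_in_family(1)[OF uv] solution_in_family(1)[OF bimodal_NE_solutions_swap[OF uv]] assms
    by linarith
qed

text \<open>\<open>S1\<close> collects the solutions in which \<open>u\<close> has the larger
  energy, and \<open>S2\<close> is its mirror image. This gives both the disjointness and the equal
  cardinalities.\<close>

lemma solutions_inside:
  assumes B: "(n1, n2) \<in> Bstar lam \<beta> k"
  shows "S = S1 \<union> S2" "S1 \<inter> S2 = {}" "card S1 = 4" "card S2 = 4" "card S = 8"
proof -
  have s: "\<sigma> \<noteq> 0" and d: "\<Phi>\<^sup>2 > 4" and XW: "X\<^sup>2 \<noteq> W\<^sup>2"
    using Bstar_imp[OF B] by auto
  obtain x y where xy: "x > 0" "y > 0" "x + y + \<beta> = f" "x * X\<^sup>2 + y * W\<^sup>2 + \<beta> = g"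
    using Bstar_imp(4)[OF B] by blast
  note family = card_solution_family[of e n1 n2 \<rho> lam, OF _ _ _ rho_pos lam_pos b_pos XW xy]
  have on: "inner (e n1) (e n1) = 1" "inner (e n2) (e n2) = 1" "inner (e n1) (e n2) = 0"
    using n orthonormal by auto
  have swap: "S2 = prod.swap ` S1"
    by (rule solution_family_swap[OF X_mult_Y[OF s d] W_mult_Z[OF s d]])
  have S1: "(u, v) \<in> S \<and> Hnorm lam e 1 v < Hnorm lam e 1 u" if uv: "(u, v) \<in> S1" for u v
  proof -
    obtain r t where rt: "r \<noteq> 0" "t \<noteq> 0" "u = r *\<^sub>R e n1 + t *\<^sub>R e n2"
      "v = (r * X) *\<^sub>R e n1 + (t * W) *\<^sub>R e n2"
      "\<rho> * r\<^sup>2 * a + \<rho> * t\<^sup>2 * b + \<beta> = f" "\<rho> * r\<^sup>2 * a * X\<^sup>2 + \<rho> * t\<^sup>2 * b * W\<^sup>2 + \<beta> = g"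
      using family(2)[OF on uv] by (elim exE conjE)
    have C: "\<beta> + \<rho> * (r\<^sup>2 * a + t\<^sup>2 * b) = f" and E: "\<beta> + \<rho> * ((r * X)\<^sup>2 * a + (t * W)\<^sup>2 * b) = g"
      unfolding rt(5,6)[symmetric] by (simp_all add: power_mult_distrib algebra_simps)
    have "weak_solution lam e \<beta> \<rho> k u v"
      unfolding rt(3,4) weak_solution_two_modes[OF n'] C E by (intro conjI mode_equations[OF s d])
    moreover have "bimodal e n1 n2 u v"
    proof -
      have "r * X \<noteq> 0" "t * W \<noteq> 0"
        using rt(1,2) X_mult_Y[OF s d] W_mult_Z[OF s d] by auto
      then show ?thesis
        unfolding bimodal_def rt(3,4) by (intro conjI exI n' rt(1,2)) auto
    qed
    moreover have "\<rho> * (Hnorm lam e 1 v)\<^sup>2 < \<rho> * (Hnorm lam e 1 u)\<^sup>2"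
      unfolding rt(3,4) Hnorm_two_modes[OF n'] using C E g_less_f[OF s d] by linarith
    then have "Hnorm lam e 1 v < Hnorm lam e 1 u"
      using rho_pos by (auto intro: power2_less_imp_less simp: Hnorm_def)
    ultimately show ?thesis
      unfolding bimodal_NE_solutions_def by auto
  qed
  show S: "S = S1 \<union> S2"
  proof
    show "S \<subseteq> S1 \<union> S2"
    proof (clarify)
      fix u v assume uv: "(u, v) \<in> S" and no: "(u, v) \<notin> S2"
      have "Hnorm lam e 1 u \<noteq> Hnorm lam e 1 v"
        using uv by (simp add: bimodal_NE_solutions_def)
      then consider "Hnorm lam e 1 v < Hnorm lam e 1 u" | "Hnorm lam e 1 u < Hnorm lam e 1 v"
        by linarith
      then show "(u, v) \<in> S1"
      proof cases
        case 1
        then show ?thesis using solution_in_family(2)[OF uv] by blast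
      next
        case 2
        then have "(v, u) \<in> S1"
          using solution_in_family(2)[OF bimodal_NE_solutions_swap[OF uv]] by blast
        then have "(u, v) \<in> S2"
          unfolding swap by (force simp: image_iff)
        with no show ?thesis by blast
      qed
    qed
    show "S1 \<union> S2 \<subseteq> S"
      unfolding swap using S1 bimodal_NE_solutions_swap by auto
  qed
  show dis: "S1 \<inter> S2 = {}"
  proof (rule equals0I)
    fix w assume "w \<in> S1 \<inter> S2"
    then have "(fst w, snd w) \<in> S1" "(snd w, fst w) \<in> S1"
      unfolding swap by auto
    then show False
      using S1 less_asym by blast
  qed
  show c1: "card S1 = 4"
    by (rule family(1)[OF on])
  then show c2: "card S2 = 4"
    unfolding swap by (simp add: card_image)
  have "finite S1" "finite S2"
    using c1 c2 by (auto intro: card_ge_0_finite)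
  then show "card S = 8"
    unfolding S using c1 c2 dis by (simp add: card_Un_disjoint)
qed

end

section \<open>Finiteness of \<open>Bstar\<close>\<close>

context spectral
begin

text \<open>Since \<open>card\<close> is 0 on infinite sets, the counting formula has its intended
  meaning only with finiteness. It holds because \<open>lam n2\<close> is bounded on
  \<open>Bstar\<close> while the eigenvalues tend to infinity.\<close>

lemma finite_Bstar:
  assumes k: "k > 0"
  shows "finite (Bstar lam \<beta> k)"
proof -
  \<comment> \<open>The first entry bounds \<open>b\<close> on \<open>B1star\<close>, where
    \<open>a * b < 2 * k\<close> and \<open>a\<close> is at least \<open>lam 1\<close>. The second
    does so on \<open>B2star\<close>, where \<open>b / 2 \<le> M < -\<beta>\<close>.\<close>
  define K where "K = max (2 * k / lam 1) (2 * \<bar>\<beta>\<bar>)"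
  have "filterlim lam at_top sequentially"
    using sd by (simp add: simple_spectral_data_def)
  then obtain N where N: "\<And>n. n \<ge> N \<Longrightarrow> K < lam n"
    unfolding filterlim_at_top_dense eventually_sequentially by blast
  have "n1 < N \<and> n2 < N" if B: "(n1, n2) \<in> Bstar lam \<beta> k" for n1 n2
  proof -
    have n: "1 \<le> n1" "n1 < n2"
      using B by (auto simp: Bstar_def B1star_def B2star_def)
    interpret mode_pair lam n1 n2 k
      by (rule mode_pair[OF n k])
    have "b \<le> K"
      using B unfolding Bstar_def
    proof
      assume "(n1, n2) \<in> B1star lam \<beta> k"
      then have "a * b < 2 * k"
        by (simp add: B1star_def)
      moreover have "lam 1 \<le> a"
        using lam_mono[of 1 n1] n by (cases "n1 = 1") auto
      then have "lam 1 * b \<le> a * b"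
        using b_pos by simp
      ultimately have "b \<le> 2 * k / lam 1"
        using lam_positive[of 1] by (simp add: field_simps)
      then show ?thesis
        by (simp add: K_def)
    next
      assume "(n1, n2) \<in> B2star lam \<beta> k"
      then have M: "M < - \<beta>" and l: "2 * k < a * (b - a)"
        by (auto simp: B2star_def)
      have "a * (b - a) = a * b - a\<^sup>2"
        by (simp add: algebra_simps power2_eq_square)
      moreover have "a\<^sup>2 > 0"
        using lam_pos by simp
      ultimately have ab: "2 * k < a * b"
        using l by linarith
      have "(a * b) * (2 * k) \<le> (a * b) * (a * b)"
        using ab lam_pos b_pos by (intro mult_left_mono) auto
      moreover have "k * a * (b - a) \<le> k * (a * b)"
        using k lam_pos by (simp add: algebra_simps)
      \<comment> \<open>As \<open>2 * k < a * b\<close>, the negative term costs the numerator of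
        \<open>M\<close> at most half of \<open>(a * b)\<^sup>2\<close>; the denominator is at most
        \<open>a * b * a\<close>, whence \<open>M\<close> is at least \<open>b / 2\<close>.\<close>
      ultimately have num: "(a * b) * (a * b) / 2 \<le> k\<^sup>2 - k * a * (b - a) + a\<^sup>2 * b\<^sup>2"
        using mult_pos_pos[OF k k] by (simp add: power2_eq_square algebra_simps)
      have "b / 2 * ((a * b - k) * a) \<le> (a * b) * (a * b) / 2"
        using k lam_pos b_pos by (simp add: algebra_simps)
      also note num
      finally have "b / 2 \<le> M"
        unfolding M_up_def using ab k lam_pos by (subst pos_le_divide_eq) auto
      then show ?thesis
        using M by (simp add: K_def)
    qed
    then have "n2 < N"
      using N[of n2] by (meson not_le)
    then show ?thesis
      using n by simp
  qed
  then have "Bstar lam \<beta> k \<subseteq> {..<N} \<times> {..<N}"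
    by auto
  then show ?thesis
    by (rule finite_subset) simp
qed

end

theorem theorem6p8:
  fixes D :: "'a::{real_inner, complete_space, second_countable_topology} set"
    and A :: "'a \<Rightarrow> 'a" and lam :: "nat \<Rightarrow> real" and e :: "nat \<Rightarrow> 'a"
    and \<beta> \<rho> k :: real
  assumes "selfadjoint_op D A"
    and "strictly_positive_op D A"
    and "compactly_embedded_domain D A"
    and "simple_spectral_data D A lam e"
    and "\<rho> > 0" and "k > 0"
  shows "(all_bimodal_NE_solutions lam e \<beta> \<rho> k \<noteq> {} \<longleftrightarrow> Bstar lam \<beta> k \<noteq> {}) \<and>
    (\<forall>n1 n2. 1 \<le> n1 \<and> n1 < n2 \<longrightarrow>
      (let S = bimodal_NE_solutions lam e \<beta> \<rho> k n1 n2;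
           \<Phi> = Phi lam k n1 n2; \<Psi> = Psi lam k n1 n2;
           X = Xc lam k n1 n2; Y = Yc lam k n1 n2; W = Wc lam k n1 n2; Z = Zc lam k n1 n2;
           f = fc lam k n1 n2; g = gc lam k n1 n2;
           S1 = solution_family lam e \<beta> \<rho> n1 n2 X W f g;
           S2 = solution_family lam e \<beta> \<rho> n1 n2 Y Z g f
       in ((n1, n2) \<in> Bstar lam \<beta> k \<longrightarrow>
             sigmac lam k n1 n2 \<noteq> 0 \<and> \<Phi>\<^sup>2 \<ge> 4 \<and> \<Psi>\<^sup>2 \<ge> 4 \<and>
             card S = 8 \<and> S = S1 \<union> S2 \<and> S1 \<inter> S2 = {} \<and> card S1 = 4 \<and> card S2 = 4) \<and>
          ((n1, n2) \<notin> Bstar lam \<beta> k \<longrightarrow> S = {}))) \<and>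
    finite (Bstar lam \<beta> k) \<and>
    finite (all_bimodal_NE_solutions lam e \<beta> \<rho> k) \<and>
    card (all_bimodal_NE_solutions lam e \<beta> \<rho> k) = 8 * card (Bstar lam \<beta> k)"
proof -
  interpret spectral D A lam e
    by unfold_locales (fact assms)+
  let ?S = "bimodal_NE_solutions lam e \<beta> \<rho> k" and ?B = "Bstar lam \<beta> k"
  let ?all = "all_bimodal_NE_solutions lam e \<beta> \<rho> k"
  have solutions: "mode_pair_solutions D A lam e n1 n2 k \<rho>" if "1 \<le> n1" "n1 < n2" for n1 n2
    using mode_pair[OF that \<open>k > 0\<close>] that \<open>\<rho> > 0\<close> spectral_axioms
    by (simp add: mode_pair_solutions_def mode_pair_solutions_axioms_def)
  note inside = mode_pair_solutions.solutions_inside[OF solutions]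
    and outside = mode_pair_solutions.solutions_outside[OF solutions]
  have B_less: "1 \<le> n1 \<and> n1 < n2" if "(n1, n2) \<in> ?B" for n1 n2
    using that by (auto simp: Bstar_def B1star_def B2star_def)
  have all: "?all = (\<Union>p\<in>?B. ?S (fst p) (snd p))"
  proof
    show "?all \<subseteq> (\<Union>p\<in>?B. ?S (fst p) (snd p))"
    proof
      fix w assume "w \<in> ?all"
      then obtain m1 m2 where m: "w \<in> ?S m1 m2"
        by (auto simp: all_bimodal_NE_solutions_def)
      then have m12: "1 \<le> m1" "1 \<le> m2" "m1 \<noteq> m2"
        by (auto simp: bimodal_NE_solutions_def bimodal_def)
      have "\<exists>n1 n2. 1 \<le> n1 \<and> n1 < n2 \<and> w \<in> ?S n1 n2"
        using m m12 bimodal_NE_solutions_commute[of \<beta> \<rho> k m1 m2] by (metis linorder_neqE_nat)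
      then obtain n1 n2 where n: "1 \<le> n1" "n1 < n2" and w: "w \<in> ?S n1 n2"
        by blast
      have "(n1, n2) \<in> ?B"
        using outside[OF n] w by blast
      with w show "w \<in> (\<Union>p\<in>?B. ?S (fst p) (snd p))"
        by force
    qed
  qed (auto simp: all_bimodal_NE_solutions_def)
  have card8: "card (?S (fst p) (snd p)) = 8" if "p \<in> ?B" for p
    using inside(5)[of "fst p" "snd p"] B_less[of "fst p" "snd p"] that by simp
  have fin: "finite (?S (fst p) (snd p))" if "p \<in> ?B" for p
    using card8[OF that] by (intro card_ge_0_finite) simp
  have disj: "?S (fst p) (snd p) \<inter> ?S (fst q) (snd q) = {}" if "p \<in> ?B" "q \<in> ?B" "p \<noteq> q" for p q
  proof -
    have "1 \<le> fst p" "fst p < snd p" "1 \<le> fst q" "fst q < snd q"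
      using B_less[of "fst p" "snd p"] B_less[of "fst q" "snd q"] that by simp_all
    note unique = solution_modes_unique[OF this]
    show ?thesis
    proof (rule equals0I)
      fix w assume "w \<in> ?S (fst p) (snd p) \<inter> ?S (fst q) (snd q)"
      then have "p = q"
        using unique[of "fst w" "snd w"] by (intro prod_eqI) auto
      with that(3) show False ..
    qed
  qed
  have finB: "finite ?B"
    by (rule finite_Bstar[OF \<open>k > 0\<close>])
  have finall: "finite ?all"
    unfolding all using finB fin by blast
  have "card ?all = (\<Sum>p\<in>?B. card (?S (fst p) (snd p)))"
    unfolding all by (rule card_UN_disjoint) (use finB fin disj in auto)
  then have cardall: "card ?all = 8 * card ?B"
    using card8 by simp
  \<comment> \<open>Both sets being finite, the existence criterion is read off the cardinality
    formula.\<close>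
  then have nonempty: "?all \<noteq> {} \<longleftrightarrow> ?B \<noteq> {}"
    using card_0_eq[OF finB] card_0_eq[OF finall] by simp
  have pair: "sigmac lam k n1 n2 \<noteq> 0" "(Phi lam k n1 n2)\<^sup>2 \<ge> 4" "(Psi lam k n1 n2)\<^sup>2 \<ge> 4"
    if B: "(n1, n2) \<in> ?B" for n1 n2
  proof -
    interpret mode_pair lam n1 n2 k
      using mode_pair B_less[OF B] \<open>k > 0\<close> by blast
    have s: "\<sigma> \<noteq> 0" and d: "\<Phi>\<^sup>2 > 4"
      using Bstar_imp[OF B] by auto
    have "\<Psi>\<^sup>2 - 4 \<ge> 0"
      unfolding Psi_disc[OF s] using d by simp
    with s d show "\<sigma> \<noteq> 0" "\<Phi>\<^sup>2 \<ge> 4" "\<Psi>\<^sup>2 \<ge> 4" by simp_all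
  qed
  show ?thesis
    unfolding Let_def
    by (intro conjI allI impI; (elim conjE)?;
        (rule nonempty finB finall cardall | (rule pair inside outside; assumption)))
qed

end
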